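(* Let $\mathfrak{sl}_2$ denote $\mathfrak{sl}_2(\mathbb{F}_p)$ for $p$ an odd prime, and let $S^i$ denote the module of homogeneous degree $i$ polynomials on $\mathfrak{sl}_2$ equipped with the dual adjoint action. Then for $i\ge p-2$ the following sequence is exact: $$0\to H^3(\mathfrak{sl}_2,S^i)\to H^2(\mathfrak{sl}_2,S^{i+1})\to H^1(\mathfrak{sl}_2,S^{i+2})\to H^0(\mathfrak{sl}_2,S^{i+3})\to0,$$ where the maps are those induced by the derivation $d_1$.
   Context: Let $e_1,e_2,e_3$ be a basis of $\mathfrak{sl}_2$ with structure constants $[e_i,e_j]=\sum_kc_{ij}^ke_k$, $x_i$ the dual basis in $\Lambda^1(\mathfrak{sl}_2^* )$, $y_i$ the same dual basis in $Poly^1(\mathfrak{sl}_2^* )=S^1$. Let $E_0=\Lambda^*(x_1,x_2,x_3)\otimes\mathbb{F}_p[y_1,y_2,y_3]$ with $x_i$ of total degree $1$ and $y_i$ of total degree $2$, and let $E_0^{s,t}$ be the part of polynomial degree $s$ and exterior degree $t$. Define derivations (signs by total degree) $d_0(x_i)=-\sum_{j<k}c_{jk}^ix_jx_k$, $d_0(y_i)=\sum_{j,k}c_{jk}^iy_jx_k$ and $d_1(x_i)=y_i$, $d_1(y_i)=0$. These anticommute; $H^t(\mathfrak{sl}_2,S^s)$ is the $d_0$-cohomology at $E_0^{s,t}$, and $d_1$ induces maps $H^t(\mathfrak{sl}_2,S^s)\to H^{t-1}(\mathfrak{sl}_2,S^{s+1})$. *)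

theory Defs
  imports
    "HOL-Analysis.Determinants"
    "HOL-Library.Poly_Mapping"
    "HOL-Computational_Algebra.Primes"
    "HOL-Algebra.Exact_Sequence"
begin

section \<open>The exterior algebra over a commutative ring\<close>

text \<open>
  The exterior algebra over \<open>'r\<close> on generators \<open>x\<^sub>i\<close> indexed by the linearly ordered finite type
  \<open>'i\<close>.  An element is given by its coefficients with respect to the monomials
  \<open>x\<^sub>S = x\<^sub>i\<^sub>1 \<cdots> x\<^sub>i\<^sub>t\<close> for \<open>S = {i\<^sub>1 < \<cdots> < i\<^sub>t}\<close>.
\<close>

typedef ('i, 'r) exterior = "UNIV :: ('i set \<Rightarrow> 'r) set"
  morphisms ext_coeff Ext
  by simp

lemma ext_coeff_Ext [simp]: "ext_coeff (Ext f) = f"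
  by (simp add: Ext_inverse)

lemma exterior_eqI: "(\<And>S. ext_coeff a S = ext_coeff b S) \<Longrightarrow> a = b"
  by (metis ext_coeff_inject ext)

text \<open>
  For disjoint \<open>S\<close> and \<open>T\<close>, \<open>x\<^sub>S x\<^sub>T = ext_sign S T x\<^sub>S\<^sub>\<union>\<^sub>T\<close>: the sign counts the
  transpositions needed to sort the concatenation.
\<close>

definition ext_sign :: "'i::linorder set \<Rightarrow> 'i set \<Rightarrow> 'r::comm_ring_1" where
  "ext_sign S T = (-1) ^ card {(i, j). i \<in> S \<and> j \<in> T \<and> j < i}"

instantiation exterior :: ("{finite,linorder}", comm_ring_1) ring_1
begin

definition "0 = Ext (\<lambda>S. 0)"
definition "1 = Ext (\<lambda>S. if S = {} then 1 else 0)"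
definition "a + b = Ext (\<lambda>S. ext_coeff a S + ext_coeff b S)"
definition "- a = Ext (\<lambda>S. - ext_coeff a S)"
definition "a - b = Ext (\<lambda>S. ext_coeff a S - ext_coeff b S)"
definition "a * b = Ext (\<lambda>U. \<Sum>S\<in>Pow U. ext_sign S (U - S) * ext_coeff a S * ext_coeff b (U - S))"

lemma ext_coeff_simps [simp]:
  "ext_coeff 0 S = 0"
  "ext_coeff 1 S = (if S = {} then 1 else 0)"
  "ext_coeff (a + b) S = ext_coeff a S + ext_coeff b S"
  "ext_coeff (- a) S = - ext_coeff a S"
  "ext_coeff (a - b) S = ext_coeff a S - ext_coeff b S"
  by (simp_all add: zero_exterior_def one_exterior_def plus_exterior_def uminus_exterior_def
      minus_exterior_def)

lemma ext_coeff_mult: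
  "ext_coeff (a * b) U = (\<Sum>S\<in>Pow U. ext_sign S (U - S) * ext_coeff a S * ext_coeff b (U - S))"
  by (simp add: times_exterior_def)

lemma ext_sign_empty [simp]: "ext_sign {} T = 1" "ext_sign S {} = 1"
  by (simp_all add: ext_sign_def)

lemma ext_sign_Un1:
  fixes A B C :: "'i::{finite,linorder} set"
  assumes "A \<inter> B = {}"
  shows "ext_sign (A \<union> B) C = (ext_sign A C * ext_sign B C :: 'r::comm_ring_1)"
proof -
  have "{(i, j). i \<in> A \<union> B \<and> j \<in> C \<and> j < i} =
      {(i, j). i \<in> A \<and> j \<in> C \<and> j < i} \<union> {(i, j). i \<in> B \<and> j \<in> C \<and> j < i}" by auto
  moreover have "card \<dots> = card {(i, j). i \<in> A \<and> j \<in> C \<and> j < i}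
      + card {(i, j). i \<in> B \<and> j \<in> C \<and> j < i}"
    by (rule card_Un_disjoint) (use assms in auto)
  ultimately show ?thesis by (simp add: ext_sign_def power_add)
qed

lemma ext_sign_Un2:
  fixes A B C :: "'i::{finite,linorder} set"
  assumes "A \<inter> B = {}"
  shows "ext_sign C (A \<union> B) = (ext_sign C A * ext_sign C B :: 'r::comm_ring_1)"
proof -
  have "{(i, j). i \<in> C \<and> j \<in> A \<union> B \<and> j < i} =
      {(i, j). i \<in> C \<and> j \<in> A \<and> j < i} \<union> {(i, j). i \<in> C \<and> j \<in> B \<and> j < i}" by auto
  moreover have "card \<dots> = card {(i, j). i \<in> C \<and> j \<in> A \<and> j < i}
      + card {(i, j). i \<in> C \<and> j \<in> B \<and> j < i}"
    by (rule card_Un_disjoint) (use assms in auto)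
  ultimately show ?thesis by (simp add: ext_sign_def power_add)
qed

instance
proof
  fix a b c :: "('a, 'b) exterior"
  show "a * b * c = a * (b * c)"
  proof (rule exterior_eqI)
    fix U :: "'a set"
    let ?l = "\<lambda>(S, T). ext_sign S (U - S) * (ext_sign T (S - T) * ext_coeff a T * ext_coeff b (S - T))
        * ext_coeff c (U - S)"
    let ?r = "\<lambda>(T, R). ext_sign T (U - T) * ext_coeff a T *
        (ext_sign R (U - T - R) * ext_coeff b R * ext_coeff c (U - T - R))"
    have "ext_coeff (a * b * c) U = sum ?l (Sigma (Pow U) Pow)"
      by (simp add: ext_coeff_mult sum_distrib_left sum_distrib_right sum.Sigma)
    also have "\<dots> = sum ?r (Sigma (Pow U) (\<lambda>T. Pow (U - T)))"
    proof (rule sum.reindex_bij_witness[where j = "\<lambda>(S, T). (T, S - T)" and i = "\<lambda>(T, R). (T \<union> R, T)"])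
      fix q assume "q \<in> Sigma (Pow U) Pow"
      then obtain S T where q: "q = (S, T)" "S \<subseteq> U" "T \<subseteq> S" by auto
      define R C where "R = S - T" and "C = U - S"
      have eq: "U - T = R \<union> C" "U - T - R = C" "S = T \<union> R" "R \<inter> C = {}" "T \<inter> R = {}"
        using q by (auto simp: R_def C_def)
      have "ext_sign S C * ext_sign T R = ext_sign T (U - T) * (ext_sign R C :: 'b)"
        unfolding eq(1) by (simp add: eq(3) ext_sign_Un1 ext_sign_Un2 eq(4,5) mult_ac)
      then have "ext_sign S C * ext_sign T R * (ext_coeff a T * ext_coeff b R * ext_coeff c C) =
          ext_sign T (U - T) * ext_sign R C * (ext_coeff a T * ext_coeff b R * ext_coeff c C)"
        by simp
      then show "?r ((\<lambda>(S, T). (T, S - T)) q) = ?l q"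
        unfolding q prod.case R_def[symmetric] eq(2) C_def[symmetric] by (simp add: mult_ac)
    qed auto
    also have "\<dots> = ext_coeff (a * (b * c)) U"
      by (simp add: ext_coeff_mult sum_distrib_left sum.Sigma)
    finally show "ext_coeff (a * b * c) U = ext_coeff (a * (b * c)) U" .
  qed
  show "1 * a = a"
  proof (rule exterior_eqI)
    fix U :: "'a set"
    have "ext_coeff (1 * a) U = (\<Sum>S\<in>{{}}. ext_sign S (U - S) * ext_coeff 1 S * ext_coeff a (U - S))"
      unfolding ext_coeff_mult by (rule sum.mono_neutral_right) auto
    then show "ext_coeff (1 * a) U = ext_coeff a U" by simp
  qed
  show "a * 1 = a"
  proof (rule exterior_eqI)
    fix U :: "'a set"
    have "ext_coeff (a * 1) U = (\<Sum>S\<in>{U}. ext_sign S (U - S) * ext_coeff a S * ext_coeff 1 (U - S))"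
      unfolding ext_coeff_mult by (rule sum.mono_neutral_right) auto
    then show "ext_coeff (a * 1) U = ext_coeff a U" by simp
  qed
  show "(a + b) * c = a * c + b * c" "a * (b + c) = a * b + a * c"
    by (rule exterior_eqI, simp add: ext_coeff_mult algebra_simps sum.distrib)+
  show "(0 :: ('a, 'b) exterior) \<noteq> 1"
    by (metis ext_coeff_simps(1,2) zero_neq_one)
qed (rule exterior_eqI, simp add: algebra_simps)+

end

definition ext_gen :: "'i::{finite,linorder} \<Rightarrow> ('i, 'r::comm_ring_1) exterior" where
  "ext_gen i = Ext (\<lambda>S. if S = {i} then 1 else 0)"

definition ext_scalar :: "'r::comm_ring_1 \<Rightarrow> ('i::{finite,linorder}, 'r) exterior" where
  "ext_scalar r = Ext (\<lambda>S. if S = {} then r else 0)"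

lemma ext_coeff_gen: "ext_coeff (ext_gen i) S = (if S = {i} then 1 else 0)"
  by (simp add: ext_gen_def)

lemma ext_coeff_scalar: "ext_coeff (ext_scalar r) S = (if S = {} then r else 0)"
  by (simp add: ext_scalar_def)

lemma ext_coeff_gen_mult:
  "ext_coeff (ext_gen i * a) U = (if i \<in> U then ext_sign {i} (U - {i}) * ext_coeff a (U - {i}) else 0)"
proof -
  have "ext_coeff (ext_gen i * a) U =
      (\<Sum>S\<in>Pow U. if S = {i} then ext_sign {i} (U - {i}) * ext_coeff a (U - {i}) else 0)"
    unfolding ext_coeff_mult by (rule sum.cong) (auto simp: ext_coeff_gen)
  then show ?thesis by simp
qed

lemma ext_scalar_mult: "ext_coeff (ext_scalar r * a) U = r * ext_coeff a U"
proof -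
  have "ext_coeff (ext_scalar r * a) U = (\<Sum>S\<in>Pow U. if S = {} then r * ext_coeff a U else 0)"
    unfolding ext_coeff_mult by (rule sum.cong) (auto simp: ext_coeff_scalar)
  then show ?thesis by simp
qed

lemma mult_ext_scalar: "ext_coeff (a * ext_scalar r) U = r * ext_coeff a U"
proof -
  have "ext_coeff (a * ext_scalar r) U = (\<Sum>S\<in>Pow U. if S = U then r * ext_coeff a U else 0)"
    unfolding ext_coeff_mult by (rule sum.cong) (auto simp: ext_coeff_scalar)
  then show ?thesis by simp
qed

lemma ext_scalar_central: "ext_scalar r * a = a * ext_scalar r"
  by (rule exterior_eqI) (simp add: ext_scalar_mult mult_ext_scalar)

lemma ext_scalar_hom:
  "ext_scalar (q + r) = ext_scalar q + ext_scalar r"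
  "ext_scalar (q * r) = ext_scalar q * ext_scalar r"
  "ext_scalar 1 = 1"
  by (rule exterior_eqI, simp add: ext_coeff_scalar ext_scalar_mult)+

lemma ext_gen_square: "ext_gen i * ext_gen i = 0"
  by (rule exterior_eqI) (auto simp: ext_coeff_gen_mult ext_coeff_gen)

lemma ext_sign_singletons:
  "ext_sign {i} {j} = (if j < i then -1 else (1::'r::comm_ring_1))"
proof -
  have "{(i', j'). i' \<in> {i} \<and> j' \<in> {j} \<and> j' < i'} = (if j < i then {(i, j)} else {})"
    by auto
  then show ?thesis by (simp add: ext_sign_def)
qed

lemma ext_gen_anticommute:
  "ext_gen i * ext_gen j = - (ext_gen j * ext_gen i :: ('a::{finite,linorder}, 'b::comm_ring_1) exterior)"
proof (cases "i = j")
  case True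
  then show ?thesis by (simp add: ext_gen_square)
next
  case False
  show ?thesis
  proof (rule exterior_eqI)
    fix U :: "'a set"
    show "ext_coeff (ext_gen i * ext_gen j) U = ext_coeff (- (ext_gen j * ext_gen i) :: ('a, 'b) exterior) U"
    proof (cases "U = {i, j}")
      case True
      with False have "U - {i} = {j}" "U - {j} = {i}" "i \<in> U" "j \<in> U" by auto
      then have ij: "ext_coeff (ext_gen i * ext_gen j :: ('a, 'b) exterior) U = ext_sign {i} {j}"
        and ji: "ext_coeff (ext_gen j * ext_gen i :: ('a, 'b) exterior) U = ext_sign {j} {i}"
        by (simp_all only: ext_coeff_gen_mult ext_coeff_gen refl if_True mult_1_right)
      have "ext_sign {i} {j} = (- ext_sign {j} {i} :: 'b)"
        using False by (cases i j rule: linorder_cases) (simp_all add: ext_sign_singletons)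
      then show ?thesis by (simp only: ext_coeff_simps ij ji)
    next
      case neq: False
      have "ext_coeff (ext_gen i * ext_gen j :: ('a, 'b) exterior) U = 0"
        unfolding ext_coeff_gen_mult ext_coeff_gen using neq by (auto dest: insert_Diff)
      moreover have "ext_coeff (ext_gen j * ext_gen i :: ('a, 'b) exterior) U = 0"
        unfolding ext_coeff_gen_mult ext_coeff_gen using neq by (auto dest: insert_Diff)
      ultimately show ?thesis by simp
    qed
  qed
qed


section \<open>The bigraded algebra \<open>E\<^sub>0\<close>\<close>

text \<open>
  \<open>\<Lambda>\<^sup>*(x\<^sub>1,x\<^sub>2,x\<^sub>3) \<otimes> k[y\<^sub>1,y\<^sub>2,y\<^sub>3]\<close> is realised as the exterior algebra over the ring
  \<open>k[y\<^sub>1,y\<^sub>2,y\<^sub>3]\<close>; since the \<open>y\<^sub>i\<close> have even degree they are central.  The indices \<open>1, 2, 3\<close> are the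
  elements of the three-element type \<open>3\<close>, where \<open>3 = 0\<close>.
\<close>

type_synonym 'k poly3 = "(3 \<Rightarrow>\<^sub>0 nat) \<Rightarrow>\<^sub>0 'k"

type_synonym 'k E0 = "(3, 'k poly3) exterior"

definition const :: "'k::field \<Rightarrow> 'k E0" where
  "const c = ext_scalar (Poly_Mapping.single 0 c)"

definition gen_x :: "3 \<Rightarrow> 'k::field E0" where
  "gen_x i = ext_gen i"

definition gen_y :: "3 \<Rightarrow> 'k::field E0" where
  "gen_y i = ext_scalar (Poly_Mapping.single (Poly_Mapping.single i 1) 1)"

definition homogeneous :: "nat \<Rightarrow> 'k::field poly3 set" where
  "homogeneous s = {q. \<forall>m\<in>Poly_Mapping.keys q. (\<Sum>i\<in>UNIV. Poly_Mapping.lookup m i) = s}"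

definition E0_part :: "nat \<Rightarrow> nat \<Rightarrow> 'k::field E0 set" where
  "E0_part s t = {a. \<forall>S. ext_coeff a S \<in> homogeneous s \<and> (card S \<noteq> t \<longrightarrow> ext_coeff a S = 0)}"

definition graded_derivation :: "('k::field E0 \<Rightarrow> 'k E0) \<Rightarrow> bool" where
  "graded_derivation d \<longleftrightarrow>
     (\<forall>a b. d (a + b) = d a + d b) \<and>
     (\<forall>c a. d (const c * a) = const c * d a) \<and>
     (\<forall>s t a b. a \<in> E0_part s t \<longrightarrow> d (a * b) = d a * b + (-1) ^ (2 * s + t) * a * d b)"


section \<open>Cohomology\<close>

definition cocycle_group :: "('k::field E0 \<Rightarrow> 'k E0) \<Rightarrow> nat \<Rightarrow> nat \<Rightarrow> 'k E0 monoid" where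
  "cocycle_group d s t = \<lparr>carrier = {a \<in> E0_part s t. d a = 0}, monoid.mult = (+), one = 0\<rparr>"

definition coboundaries :: "('k::field E0 \<Rightarrow> 'k E0) \<Rightarrow> nat \<Rightarrow> nat \<Rightarrow> 'k E0 set" where
  "coboundaries d s t = (if t = 0 then {0} else d ` E0_part s (t - 1))"

text \<open>\<open>cohom d0 t s\<close> is \<open>H\<^sup>t(sl\<^sub>2, S\<^sup>s)\<close>, whose elements are cosets of cocycles.\<close>

definition cohom :: "('k::field E0 \<Rightarrow> 'k E0) \<Rightarrow> nat \<Rightarrow> nat \<Rightarrow> 'k E0 set monoid" where
  "cohom d t s = cocycle_group d s t Mod coboundaries d s t"

text \<open>
  The map \<open>H\<^sup>t(sl\<^sub>2, S\<^sup>s) \<rightarrow> H\<^sup>t\<^sup>-\<^sup>1(sl\<^sub>2, S\<^sup>s\<^sup>+\<^sup>1)\<close> sending the class of \<open>a\<close> to the class of \<open>d1 a\<close>,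
  for \<open>t > 0\<close>.
\<close>

definition cohom_map ::
  "('k::field E0 \<Rightarrow> 'k E0) \<Rightarrow> ('k E0 \<Rightarrow> 'k E0) \<Rightarrow> nat \<Rightarrow> nat \<Rightarrow> 'k E0 set \<Rightarrow> 'k E0 set" where
  "cohom_map d0 d1 t s X =
     the_elem ((\<lambda>a. coboundaries d0 (s + 1) (t - 1)
                      #>\<^bsub>cocycle_group d0 (s + 1) (t - 1)\<^esub> d1 a) ` X)"


section \<open>The Lie algebra \<open>sl\<^sub>2\<close>\<close>

definition mat_scale :: "'k::field \<Rightarrow> 'k^2^2 \<Rightarrow> 'k^2^2" where
  "mat_scale c A = (\<chi> i j. c * A $ i $ j)"

global_interpretation mat: vector_space mat_scale
  by unfold_locales (simp_all add: mat_scale_def vec_eq_iff algebra_simps)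

definition sl2 :: "('k::field^2^2) set" where
  "sl2 = {A. trace A = 0}"

definition bracket :: "'k::field^2^2 \<Rightarrow> 'k^2^2 \<Rightarrow> 'k^2^2" where
  "bracket A B = A ** B - B ** A"

definition sl2_basis :: "(3 \<Rightarrow> 'k::field^2^2) \<Rightarrow> bool" where
  "sl2_basis e \<longleftrightarrow> inj e \<and> mat.independent (range e) \<and> mat.span (range e) = sl2"

end

theory Submission
  imports Defs
begin

text \<open>
  The two differentials form a double complex.  Its rows, with differential \<open>d1\<close>, are Koszul complexes
  of the regular sequence \<open>y\<^sub>1, y\<^sub>2, y\<^sub>3\<close>, so they are exact in positive total degree and in every
  characteristic; the columns compute the Lie algebra cohomology.

  A diagram chase with exact rows gives exactness at \<open>H\<^sup>1\<close> and \<open>H\<^sup>2\<close> in all degrees (\<open>exact_at_H1\<close>,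
  \<open>exact_at_H2\<close>).  In the language of spectral sequences, the only differential that can prevent
  exactness at the two ends leads from \<open>H\<^sup>3(S\<^sup>s)\<close> to \<open>H\<^sup>0(S\<^sup>s\<^sup>+\<^sup>2)\<close>.  Therefore injectivity on
  \<open>H\<^sup>3(S\<^sup>i)\<close> and surjectivity onto \<open>H\<^sup>0(S\<^sup>i\<^sup>+\<^sup>3)\<close> both follow from one statement, \<open>invariant_lifts\<close>:
  an invariant polynomial of degree \<open>n \<ge> p\<close> is \<open>d1 F\<close> for some one-cocycle \<open>F\<close>.  It is used for \<open>n = i + 2\<close>
  and \<open>n = i + 3\<close>, and this is where \<open>i \<ge> p - 2\<close> is needed.

  To lift invariants, write the generic element of the Lie algebra as a matrix with rows \<open>(Z, X)\<close> and
  \<open>(Y, -Z)\<close> whose entries are linear forms, and the generic one-form likewise with entries \<open>Zeta\<close>, \<open>Xi\<close>,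
  \<open>Eta\<close>.  An invariant divisible by \<open>X\<close>, say \<open>X A\<close>, lifts to the cocycle \<open>A Xi\<close>, and the same holds for
  \<open>Y\<close> and for every isotropic linear form (\<open>lifts_isotropic\<close>).  The differential \<open>d0\<close> preserves the
  weight in which \<open>X\<close>, \<open>Y\<close>, \<open>Z\<close> have weights \<open>1\<close>, \<open>-1\<close>, \<open>0\<close>.  Hence an invariant splits into invariants
  of non-negative and of negative weight, and apart from the monomial \<open>Z\<^sup>n\<close> these are divisible by \<open>X\<close>
  and by \<open>Y\<close> (\<open>lifts_no_z_power\<close>).  It remains to remove \<open>Z\<^sup>n\<close> by subtracting one liftable invariant of
  degree \<open>n\<close> that contains it.  With \<open>Q = Z\<^sup>2 + X Y\<close> such an invariant is \<open>Q\<^sup>j (X - Y + 2 Z)\<^sup>p\<close> for odd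
  \<open>n\<close>, the linear form being isotropic, and a power of \<open>Q\<close> for even \<open>n\<close>; the essential case is
  \<open>Q\<^sup>m\<close> with \<open>2 m = p + 1\<close> (\<open>lifts_casimir_power\<close>).
\<close>

section \<open>Polynomials in three variables\<close>

definition var :: "3 \<Rightarrow> 'k::field poly3" where
  "var i = Poly_Mapping.single (Poly_Mapping.single i 1) 1"

definition cst :: "'k::field \<Rightarrow> 'k poly3" where
  "cst c = Poly_Mapping.single 0 c"

definition mdeg :: "(3 \<Rightarrow>\<^sub>0 nat) \<Rightarrow> nat" where
  "mdeg m = (\<Sum>i\<in>UNIV. Poly_Mapping.lookup m i)"

lemma mdeg_simps [simp]:
  "mdeg 0 = 0" "mdeg (m + n) = mdeg m + mdeg n" "mdeg (Poly_Mapping.single i a) = a"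
  by (simp_all add: mdeg_def lookup_add sum.distrib lookup_single when_def)

lemma homogeneous_alt: "q \<in> homogeneous s \<longleftrightarrow> (\<forall>m\<in>Poly_Mapping.keys q. mdeg m = s)"
  by (simp add: homogeneous_def mdeg_def)

lemma cst_simps [simp]: "cst 0 = 0" "cst 1 = 1" "cst (a + b) = cst a + cst b"
  "cst (- a) = - cst a" "cst (a - b) = cst a - cst b" "cst (a * b) = cst a * cst b"
  by (simp_all add: cst_def single_add single_uminus single_diff mult_single)

lemma cst_numeral [simp]: "cst (numeral n) = numeral n"
  by (simp add: cst_def)

lemma cst_of_nat: "cst (of_nat n) = of_nat n"
  by (simp add: cst_def)

lemma cst_power: "cst (a ^ n) = cst a ^ n"
  by (induction n) simp_all

lemma var_neq_0 [simp]: "var i \<noteq> 0"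
  by (metis var_def single_zero lookup_single_eq lookup_zero zero_neq_one)

lemma var_single: "var i * Poly_Mapping.single m c = Poly_Mapping.single (Poly_Mapping.single i 1 + m) c"
  by (simp add: var_def mult_single)

lemma lookup_cst_mult: "Poly_Mapping.lookup (cst a * q) m = a * Poly_Mapping.lookup q m"
  unfolding cst_def mult_map_scale_conv_mult[symmetric]
  by (simp add: Poly_Mapping.map.rep_eq when_def)

lemma poly_mapping_sum_single:
  "(\<Sum>m\<in>Poly_Mapping.keys q. Poly_Mapping.single m (Poly_Mapping.lookup q m)) = q"
proof (rule poly_mapping_eqI)
  fix n
  show "Poly_Mapping.lookup (\<Sum>m\<in>Poly_Mapping.keys q. Poly_Mapping.single m (Poly_Mapping.lookup q m)) n
      = Poly_Mapping.lookup q n"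
    by (simp add: lookup_sum lookup_single when_def in_keys_iff)
qed

lemma sum_single_induct [case_names zero add single]:
  fixes q :: "'k::field poly3"
  assumes "P 0" "\<And>p q. P p \<Longrightarrow> P q \<Longrightarrow> P (p + q)"
    and "\<And>m. m \<in> Poly_Mapping.keys q \<Longrightarrow> P (Poly_Mapping.single m (Poly_Mapping.lookup q m))"
  shows "P q"
proof -
  have "P (\<Sum>m\<in>A. Poly_Mapping.single m (Poly_Mapping.lookup q m))" if "finite A" "A \<subseteq> Poly_Mapping.keys q" for A
    using that by (induction A rule: finite_induct) (use assms in auto)
  then show ?thesis
    using poly_mapping_sum_single[of q] by (metis finite_keys order_refl)
qed

lemma monomial_split:
  fixes m :: "3 \<Rightarrow>\<^sub>0 nat"
  assumes "Poly_Mapping.lookup m i \<noteq> 0"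
  obtains m' where "m = Poly_Mapping.single i 1 + m'"
proof
  show "m = Poly_Mapping.single i 1 + (m - Poly_Mapping.single i 1)"
    using assms by (intro poly_mapping_eqI) (auto simp: lookup_add lookup_minus lookup_single when_def)
qed

lemma mdeg_eq_0: "mdeg m = 0 \<longleftrightarrow> m = 0"
  by (auto simp: mdeg_def poly_mapping_eq_iff fun_eq_iff)

lemma monomial_induct [case_names const var]:
  assumes "\<And>c. P 0 (cst c)" "\<And>s i q. P s q \<Longrightarrow> P (Suc s) (var i * q)"
  shows "P (mdeg m) (Poly_Mapping.single m c)"
proof (induction "mdeg m" arbitrary: m)
  case 0
  then have "m = 0" using mdeg_eq_0 by metis
  then show ?case using assms(1)[of c] by (simp add: cst_def)
next
  case (Suc n)
  then obtain i where "Poly_Mapping.lookup m i \<noteq> 0"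
    unfolding mdeg_def by (metis sum.neutral nat.distinct(1))
  then obtain m' where m: "m = Poly_Mapping.single i 1 + m'" by (rule monomial_split)
  then have "n = mdeg m'" using Suc(2) by simp
  then show ?case using assms(2)[OF Suc(1)[of m'], of i] m by (simp add: var_single)
qed

text \<open>
  Every homogeneous polynomial is a sum of iterated products of variables with a constant, and the
  degree is carried along.  A statement about all homogeneous polynomials is thus proved on the
  generators of the ring.
\<close>

lemma homogeneous_induct [consumes 1, case_names zero add cst var]:
  assumes "q \<in> homogeneous s" and "\<And>s. P s 0" "\<And>s p q. P s p \<Longrightarrow> P s q \<Longrightarrow> P s (p + q)"
    and "\<And>c. P 0 (cst c)" "\<And>s i q. P s q \<Longrightarrow> P (Suc s) (var i * q)"
  shows "P s q"
proof (induction q rule: sum_single_induct[where P = "P s"])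
  case (single m)
  then have "mdeg m = s" using assms(1) by (simp add: homogeneous_alt)
  then show ?case using monomial_induct[of P m] assms(4,5) by metis
qed (use assms in auto)

lemma poly3_induct [case_names add cst var]:
  assumes "\<And>p q. P p \<Longrightarrow> P q \<Longrightarrow> P (p + q)"
    and "\<And>c. P (cst c)" "\<And>i q. P q \<Longrightarrow> P (var i * q)"
  shows "P q"
proof (induction q rule: sum_single_induct)
  case zero then show ?case using assms(2)[of 0] by simp
next
  case (single m)
  show ?case using monomial_induct[of "\<lambda>_. P" m] assms by metis
qed (use assms in auto)

lemma homogeneous_0 [simp]: "0 \<in> homogeneous s"
  and homogeneous_cst: "cst c \<in> homogeneous 0"
  and homogeneous_var: "var i \<in> homogeneous 1"
  by (auto simp: homogeneous_alt cst_def var_def)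

lemma homogeneous_add: "p \<in> homogeneous s \<Longrightarrow> q \<in> homogeneous s \<Longrightarrow> p + q \<in> homogeneous s"
  using keys_add[of p q] by (auto simp: homogeneous_alt)

lemma homogeneous_uminus: "p \<in> homogeneous s \<Longrightarrow> - p \<in> homogeneous s"
  by (auto simp: homogeneous_alt in_keys_iff)

lemma homogeneous_diff: "p \<in> homogeneous s \<Longrightarrow> q \<in> homogeneous s \<Longrightarrow> p - q \<in> homogeneous s"
  using homogeneous_add[OF _ homogeneous_uminus] by fastforce

lemma homogeneous_mult: "p \<in> homogeneous s \<Longrightarrow> q \<in> homogeneous t \<Longrightarrow> p * q \<in> homogeneous (s + t)"
  using keys_mult[of p q] by (fastforce simp: homogeneous_alt)

lemma homogeneous_cst_mult: "q \<in> homogeneous s \<Longrightarrow> cst c * q \<in> homogeneous s"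
  using homogeneous_mult[OF homogeneous_cst] by fastforce

lemma homogeneous_var_mult: "q \<in> homogeneous s \<Longrightarrow> var i * q \<in> homogeneous (Suc s)"
  using homogeneous_mult[OF homogeneous_var] by fastforce

lemma homogeneous_power: "p \<in> homogeneous s \<Longrightarrow> p ^ n \<in> homogeneous (n * s)"
  by (induction n) (use homogeneous_cst[of 1] in \<open>auto intro: homogeneous_mult\<close>)

lemma homogeneous_sum: "(\<And>i. i \<in> A \<Longrightarrow> f i \<in> homogeneous s) \<Longrightarrow> sum f A \<in> homogeneous s"
  by (induction A rule: infinite_finite_induct) (auto intro: homogeneous_add)

lemma lookup_var_mult: "Poly_Mapping.lookup (var i * q) (Poly_Mapping.single i 1 + m) = Poly_Mapping.lookup q m"
proof (induction q rule: sum_single_induct)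
  case (single n)
  then show ?case by (simp add: var_single lookup_single when_def)
qed (simp_all add: lookup_add algebra_simps)

lemma homogeneous_var_cancel:
  assumes "var i * q \<in> homogeneous (Suc s)"
  shows "q \<in> homogeneous s"
  unfolding homogeneous_alt
proof
  fix m assume "m \<in> Poly_Mapping.keys q"
  then have "Poly_Mapping.single i 1 + m \<in> Poly_Mapping.keys (var i * q)"
    by (metis in_keys_iff lookup_var_mult)
  then show "mdeg m = s" using assms by (auto simp: homogeneous_alt)
qed

section \<open>Substitution and reduction modulo a variable\<close>

definition subst :: "(3 \<Rightarrow> 'k::field poly3) \<Rightarrow> 'k poly3 \<Rightarrow> 'k poly3" where
  "subst v q = (\<Sum>m\<in>Poly_Mapping.keys q. cst (Poly_Mapping.lookup q m) * (\<Prod>i\<in>UNIV. v i ^ Poly_Mapping.lookup m i))"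

lemma subst_superset:
  assumes "finite K" "Poly_Mapping.keys q \<subseteq> K"
  shows "subst v q = (\<Sum>m\<in>K. cst (Poly_Mapping.lookup q m) * (\<Prod>i\<in>UNIV. v i ^ Poly_Mapping.lookup m i))"
  unfolding subst_def by (rule sum.mono_neutral_left) (use assms in \<open>auto simp: in_keys_iff\<close>)

lemma subst_0 [simp]: "subst v 0 = 0"
  by (simp add: subst_def)

lemma subst_add [simp]: "subst v (p + q) = subst v p + subst v q"
proof -
  let ?K = "Poly_Mapping.keys p \<union> Poly_Mapping.keys q"
  have "subst v (p + q) = (\<Sum>m\<in>?K. cst (Poly_Mapping.lookup (p + q) m) * (\<Prod>i\<in>UNIV. v i ^ Poly_Mapping.lookup m i))"
    by (rule subst_superset) (use keys_add[of p q] in auto)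
  also have "\<dots> = subst v p + subst v q"
    unfolding subst_superset[of ?K p, simplified] subst_superset[of ?K q, simplified]
    by (simp add: lookup_add algebra_simps sum.distrib)
  finally show ?thesis .
qed

lemma subst_single:
  "subst v (Poly_Mapping.single m c) = cst c * (\<Prod>i\<in>UNIV. v i ^ Poly_Mapping.lookup m i)"
  by (cases "c = 0") (simp_all add: subst_def)

lemma subst_cst [simp]: "subst v (cst c) = cst c"
  unfolding cst_def subst_single by simp

lemma subst_mult [simp]: "subst v (p * q) = subst v p * subst v q"
proof (induction p rule: sum_single_induct)
  case (single m)
  show ?case
  proof (induction q rule: sum_single_induct)
    case (single n)
    show ?case
      by (simp add: mult_single subst_single lookup_add power_add prod.distrib algebra_simps)
  qed (simp_all add: algebra_simps)
qed (simp_all add: algebra_simps)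

lemma subst_var [simp]: "subst v (var i) = v i"
proof -
  have "(\<Prod>j\<in>UNIV. v j ^ Poly_Mapping.lookup (Poly_Mapping.single i 1) j) = (\<Prod>j\<in>UNIV. if j = i then v j else 1)"
    by (intro prod.cong) (auto simp: lookup_single when_def)
  then show ?thesis by (simp add: var_def subst_single)
qed

lemma subst_power [simp]: "subst v (p ^ n) = subst v p ^ n"
  using subst_cst[of v 1] by (induction n) simp_all

lemma subst_uminus [simp]: "subst v (- p) = - subst v p"
  by (metis add.right_inverse add_eq_0_iff subst_0 subst_add)

lemma subst_diff [simp]: "subst v (p - q) = subst v p - subst v q"
  by (metis subst_add subst_uminus add_uminus_conv_diff)

lemma subst_sum [simp]: "subst v (sum f A) = (\<Sum>i\<in>A. subst v (f i))"
  by (induction A rule: infinite_finite_induct) simp_all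

lemma subst_subst:
  assumes "\<And>i. subst w (v i) = var i"
  shows "subst w (subst v q) = q"
  by (induction q rule: poly3_induct) (simp_all add: assms)

lemma homogeneous_subst:
  assumes "q \<in> homogeneous s" "\<And>i. v i \<in> homogeneous 1"
  shows "subst v q \<in> homogeneous s"
  using assms(1)
proof (induction rule: homogeneous_induct)
  case (var s i q)
  then show ?case using homogeneous_mult[OF assms(2)[of i] var] by simp
qed (simp_all add: homogeneous_add homogeneous_cst)

text \<open>
  Reduction modulo a variable, kept inside the same ring.  Divisibility by the variable becomes the
  vanishing of a ring homomorphism, so that the variable is prime because the ring has no zero
  divisors.
\<close>

definition kill :: "3 \<Rightarrow> 'k::field poly3 \<Rightarrow> 'k poly3" where
  "kill i = subst (\<lambda>j. if j = i then 0 else var j)"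

lemma kill_simps [simp]:
  "kill i (p + q) = kill i p + kill i q" "kill i (p * q) = kill i p * kill i q"
  "kill i (- p) = - kill i p" "kill i (p - q) = kill i p - kill i q"
  "kill i (cst c) = cst c" "kill i 0 = 0"
  "kill i (var j) = (if j = i then 0 else var j)"
  by (simp_all add: kill_def)

lemma homogeneous_kill: "q \<in> homogeneous s \<Longrightarrow> kill i q \<in> homogeneous s"
  unfolding kill_def by (rule homogeneous_subst) (use homogeneous_var in auto)

lemma var_dvd_minus_kill: "var i dvd q - kill i q"
proof (induction q rule: poly3_induct)
  case (add p q)
  then show ?case using dvd_add[OF add] by (simp add: algebra_simps)
next
  case (var j q)
  then show ?case
    by (cases "j = i") (auto simp: right_diff_distrib[symmetric] intro: dvd_mult)
qed simp

lemma var_dvd_iff: "var i dvd q \<longleftrightarrow> kill i q = 0"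
  using var_dvd_minus_kill[of i q] by (auto elim!: dvdE)

lemma var_dvd_var_mult:
  assumes "var i dvd var j * q" "i \<noteq> j"
  shows "var i dvd q"
  using assms by (auto simp: var_dvd_iff)

section \<open>Graded pieces of the algebra\<close>

lemma gen_y_eq: "gen_y i = ext_scalar (var i)"
  by (simp add: gen_y_def var_def)

lemma const_eq: "const c = ext_scalar (cst c)"
  by (simp add: const_def cst_def)

lemma ext_scalar_simps [simp]:
  "ext_scalar 0 = 0" "ext_scalar 1 = 1" "ext_scalar (- p) = - ext_scalar p"
  by (rule exterior_eqI, simp add: ext_coeff_scalar)+

lemma ext_scalar_diff: "ext_scalar (p - q) = ext_scalar p - ext_scalar q"
  by (rule exterior_eqI, simp add: ext_coeff_scalar)

lemma ext_coeff_sum: "ext_coeff (sum f A) S = (\<Sum>i\<in>A. ext_coeff (f i) S)"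
  by (induction A rule: infinite_finite_induct) simp_all

lemma ext_scalar_eq_iff [simp]: "ext_scalar p = ext_scalar q \<longleftrightarrow> p = q"
  by (metis ext_coeff_scalar)

lemma ext_scalar_left_commute: "a * (ext_scalar p * b) = ext_scalar p * (a * b)"
  by (metis ext_scalar_central mult.assoc)

lemma ext_scalar_merge: "ext_scalar p * (ext_scalar q * b) = ext_scalar (p * q) * b"
  by (simp add: ext_scalar_hom mult.assoc)

lemma gen_x_scalar: "gen_x i * (ext_scalar p * b) = ext_scalar p * (gen_x i * b)"
  "gen_x i * ext_scalar p = ext_scalar p * gen_x i"
  by (rule ext_scalar_left_commute, rule ext_scalar_central[symmetric])

lemma ext_scalar_cancel:
  fixes a :: "'k::field E0"
  assumes "ext_scalar p * a = 0" "p \<noteq> 0"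
  shows "a = 0"
proof (rule exterior_eqI)
  fix S
  have "p * ext_coeff a S = 0" by (metis assms(1) ext_scalar_mult ext_coeff_simps(1))
  then show "ext_coeff a S = ext_coeff 0 S" using assms(2) by simp
qed

lemma E0_part_0 [simp]: "0 \<in> E0_part s t"
  by (simp add: E0_part_def)

lemma E0_part_add: "a \<in> E0_part s t \<Longrightarrow> b \<in> E0_part s t \<Longrightarrow> a + b \<in> E0_part s t"
  by (auto simp: E0_part_def intro: homogeneous_add)

lemma E0_part_uminus: "a \<in> E0_part s t \<Longrightarrow> - a \<in> E0_part s t"
  by (auto simp: E0_part_def intro: homogeneous_uminus)

lemma E0_part_diff: "a \<in> E0_part s t \<Longrightarrow> b \<in> E0_part s t \<Longrightarrow> a - b \<in> E0_part s t"
  by (auto simp: E0_part_def intro: homogeneous_diff)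

lemma E0_part_sum: "(\<And>i. i \<in> A \<Longrightarrow> f i \<in> E0_part s t) \<Longrightarrow> sum f A \<in> E0_part s t"
  by (induction A rule: infinite_finite_induct) (auto intro: E0_part_add)

lemma E0_part_scalar: "p \<in> homogeneous s \<Longrightarrow> ext_scalar p \<in> E0_part s 0"
  by (auto simp: E0_part_def ext_coeff_scalar)

lemma E0_part_zeroE:
  assumes "a \<in> E0_part s 0"
  obtains p where "a = ext_scalar p" "p \<in> homogeneous s"
proof
  show "a = ext_scalar (ext_coeff a {})"
    by (rule exterior_eqI) (use assms in \<open>auto simp: E0_part_def ext_coeff_scalar\<close>)
  show "ext_coeff a {} \<in> homogeneous s" using assms by (simp add: E0_part_def)
qed

lemma ext_sign_cases: "ext_sign S T = (1 :: 'r::comm_ring_1) \<or> ext_sign S T = (-1 :: 'r)"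
  unfolding ext_sign_def minus_one_power_iff by simp

lemma E0_part_mult:
  fixes a b :: "'k::field E0"
  assumes "a \<in> E0_part s t" "b \<in> E0_part s' t'"
  shows "a * b \<in> E0_part (s + s') (t + t')"
proof -
  have "ext_sign S (U - S) * ext_coeff a S * ext_coeff b (U - S) \<in> homogeneous (s + s')" for S U
  proof -
    have ab: "ext_coeff a S * ext_coeff b (U - S) \<in> homogeneous (s + s')"
      using assms by (auto simp: E0_part_def intro: homogeneous_mult)
    then have "- (ext_coeff a S * ext_coeff b (U - S)) \<in> homogeneous (s + s')"
      by (rule homogeneous_uminus)
    with ab show ?thesis
      using ext_sign_cases[of S "U - S", where 'r = "'k poly3"]
      by (elim disjE) (simp_all only: mult_1_left mult_minus_left)
  qed
  moreover have "ext_sign S (U - S) * ext_coeff a S * ext_coeff b (U - S) = 0"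
    if "S \<subseteq> U" "card U \<noteq> t + t'" for S U
  proof -
    have "card U = card S + card (U - S)"
      using that(1) by (metis card_Diff_subset card_mono finite le_add_diff_inverse)
    then have "card S \<noteq> t \<or> card (U - S) \<noteq> t'" using that(2) by auto
    then show ?thesis using assms by (auto simp: E0_part_def)
  qed
  ultimately have "ext_coeff (a * b) U \<in> homogeneous (s + s') \<and>
      (card U \<noteq> t + t' \<longrightarrow> ext_coeff (a * b) U = 0)" for U
    unfolding ext_coeff_mult
    by (intro conjI impI homogeneous_sum sum.neutral ballI) (simp_all add: Pow_iff)
  then show ?thesis unfolding E0_part_def by blast
qed

lemma E0_part_scalar_mult: "p \<in> homogeneous s \<Longrightarrow> a \<in> E0_part s' t \<Longrightarrow> ext_scalar p * a \<in> E0_part (s + s') t"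
  by (rule E0_part_mult[OF E0_part_scalar, where t' = t, unfolded add_0])

lemma E0_part_gen_x: "gen_x i \<in> E0_part 0 1"
  using homogeneous_cst[of 1] by (simp add: E0_part_def gen_x_def ext_coeff_gen)

lemma E0_part_const_mult: "a \<in> E0_part s t \<Longrightarrow> const c * a \<in> E0_part s t"
  unfolding const_eq by (rule E0_part_scalar_mult[OF homogeneous_cst, where s' = s, unfolded add_0])

lemma E0_part_gt_3:
  assumes "a \<in> E0_part s t" "t > 3"
  shows "a = 0"
proof (rule exterior_eqI)
  fix S :: "3 set"
  have "card S \<le> CARD(3)" by (rule card_mono[OF finite subset_UNIV])
  then have "card S \<noteq> t" using assms(2) by simp
  then show "ext_coeff a S = ext_coeff 0 S" using assms(1) unfolding E0_part_def by simp
qed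

definition ext_monomial :: "3 set \<Rightarrow> 'k::field E0" where
  "ext_monomial S = Ext (\<lambda>T. if T = S then 1 else 0)"

lemma ext_coeff_monomial: "ext_coeff (ext_monomial S) T = (if T = S then 1 else 0)"
  by (simp add: ext_monomial_def)

lemma ext_monomial_expansion: "a = (\<Sum>S\<in>UNIV. ext_scalar (ext_coeff a S) * ext_monomial S)"
  by (rule exterior_eqI) (simp add: ext_coeff_sum ext_scalar_mult ext_coeff_monomial if_distrib cong: if_cong)

lemma ext_monomial_empty: "ext_monomial {} = 1"
  by (rule exterior_eqI) (simp add: ext_coeff_monomial)

text \<open>
  A generator that precedes all factors of a monomial is multiplied from the left without a sign.
  Hence every basis monomial is the product of its generators in increasing order.
\<close>

lemma ext_monomial_insert:
  assumes "\<And>j. j \<in> S \<Longrightarrow> i < j"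
  shows "ext_monomial (insert i S) = gen_x i * (ext_monomial S :: 'k::field E0)"
proof (rule exterior_eqI)
  fix T :: "3 set"
  have i: "i \<notin> S" using assms by blast
  have "{(i', j). i' \<in> {i} \<and> j \<in> S \<and> j < i'} = {}" using assms by (auto dest: order.asym)
  then have sgn: "ext_sign {i} S = (1 :: 'k poly3)"
    unfolding ext_sign_def by (simp only: card.empty power_0)
  show "ext_coeff (ext_monomial (insert i S)) T = ext_coeff (gen_x i * (ext_monomial S :: 'k E0)) T"
  proof (cases "i \<in> T")
    case True
    then have T: "T - {i} = S \<longleftrightarrow> T = insert i S" using i by blast
    have "ext_coeff (gen_x i * (ext_monomial S :: 'k E0)) T
        = ext_sign {i} (T - {i}) * (if T - {i} = S then 1 else 0)"
      using True by (simp only: gen_x_def ext_coeff_gen_mult ext_coeff_monomial if_True)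
    also have "\<dots> = (if T = insert i S then 1 else 0)"
    proof (cases "T = insert i S")
      case True
      then have TS: "T - {i} = S" using T by blast
      show ?thesis unfolding TS sgn using True by simp
    next
      case False
      then show ?thesis using T by simp
    qed
    finally show ?thesis by (simp only: ext_coeff_monomial)
  next
    case False
    then show ?thesis by (auto simp: gen_x_def ext_coeff_gen_mult ext_coeff_monomial)
  qed
qed

text \<open>
  The algebra is generated by the \<open>x\<^sub>i\<close> and \<open>y\<^sub>i\<close>, compatibly with the bigrading.  Identities between
  derivations are proved by this rule: the Leibniz formula propagates them through a multiplication
  by a generator, so only their values on generators have to be computed.
\<close>

lemma E0_part_induct [consumes 1, case_names zero add const gen_x gen_y]:
  fixes a :: "'k::field E0"
  assumes "a \<in> E0_part s t"
    and zero: "\<And>s t. P s t 0" and add: "\<And>s t a b. P s t a \<Longrightarrow> P s t b \<Longrightarrow> P s t (a + b)"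
    and const: "\<And>c. P 0 0 (const c)"
    and x: "\<And>s t i a. P s t a \<Longrightarrow> P s (Suc t) (gen_x i * a)"
    and y: "\<And>s t i a. P s t a \<Longrightarrow> P (Suc s) t (gen_y i * a)"
  shows "P s t a"
proof -
  have const_monomial: "P 0 (card S) (const c * ext_monomial S)" for S :: "3 set" and c
    using finite[of S]
  proof (induction S rule: finite_linorder_min_induct)
    case empty
    then show ?case using const[of c] by (simp add: ext_monomial_empty)
  next
    case (insert i S)
    then have "i \<notin> S" by blast
    then show ?case using insert x[of 0 "card S" "const c * ext_monomial S" i]
      by (simp add: ext_monomial_insert ext_scalar_left_commute const_eq)
  qed
  have scaled: "P s (card S) (ext_scalar p * ext_monomial S)" if "p \<in> homogeneous s" for s p S
    using that
  proof (induction rule: homogeneous_induct)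
    case (cst c)
    then show ?case using const_monomial[of S c] by (simp add: const_eq)
  next
    case (var s i q)
    then show ?case using y[of s "card S" "ext_scalar q * ext_monomial S" i] by (simp add: gen_y_eq ext_scalar_hom mult.assoc)
  qed (simp_all add: zero add ext_scalar_hom distrib_right)
  have "P s t (ext_scalar (ext_coeff a S) * ext_monomial S)" for S
  proof (cases "card S = t")
    case True
    then show ?thesis using scaled[of "ext_coeff a S" s S] assms(1) by (auto simp: E0_part_def)
  next
    case False
    then show ?thesis using zero assms(1) by (simp add: E0_part_def)
  qed
  note summand = this
  have "P s t (\<Sum>S\<in>A. ext_scalar (ext_coeff a S) * ext_monomial S)" for A
    using finite[of A]
  proof (induction rule: finite_induct)
    case (insert S A)
    then show ?case using add[OF summand[of S] insert(3)] by simp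
  qed (simp add: zero)
  from this[of UNIV] show ?thesis unfolding ext_monomial_expansion[of a, symmetric] .
qed

lemma gen_x_square: "gen_x i * gen_x i = 0"
  by (simp add: gen_x_def ext_gen_square)

lemma gen_x_anticommute: "gen_x i * gen_x j = - (gen_x j * gen_x i)"
  unfolding gen_x_def by (rule ext_gen_anticommute)

section \<open>Graded derivations\<close>

locale derivation =
  fixes d :: "'k::field E0 \<Rightarrow> 'k E0"
  assumes graded_derivation: "graded_derivation d"
begin

lemma d_add [simp]: "d (a + b) = d a + d b"
  and d_const_mult [simp]: "d (const c * a) = const c * d a"
  using graded_derivation by (auto simp: graded_derivation_def)

lemma d_leibniz: "a \<in> E0_part s t \<Longrightarrow> d (a * b) = d a * b + (-1) ^ t * a * d b"
  using graded_derivation by (auto simp: graded_derivation_def power_add)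

lemma d_0 [simp]: "d 0 = 0"
  using d_add[of 0 0] by simp

lemma d_uminus [simp]: "d (- a) = - d a"
  by (metis add.right_inverse add_eq_0_iff d_0 d_add)

lemma d_diff [simp]: "d (a - b) = d a - d b"
  by (metis d_add d_uminus add_uminus_conv_diff)

lemma d_sum [simp]: "d (sum f A) = (\<Sum>i\<in>A. d (f i))"
  by (induction A rule: infinite_finite_induct) simp_all

lemma d_1 [simp]: "d 1 = 0"
proof -
  have "1 \<in> E0_part 0 0" using E0_part_scalar[OF homogeneous_cst[of 1]] by simp
  from d_leibniz[OF this, of 1] show ?thesis by simp
qed

lemma d_const [simp]: "d (const c) = 0"
  using d_const_mult[of c 1] by simp

lemma d_odd: "a \<in> E0_part s (Suc 0) \<Longrightarrow> d (a * b) = d a * b - a * d b"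
  using d_leibniz[of a s 1 b] by simp

lemma d_gen_x: "d (gen_x i * a) = d (gen_x i) * a - gen_x i * d a"
  by (rule d_odd) (use E0_part_gen_x in simp)

lemma d_gen_y: "d (gen_y i * a) = d (gen_y i) * a + gen_y i * d a"
  using d_leibniz[of "gen_y i" 1 0 a] E0_part_scalar[OF homogeneous_var, of i] by (simp add: gen_y_eq)

text \<open>
  A polynomial has even total degree, so no sign occurs.  The Leibniz rule is postulated for
  homogeneous left factors, but its signless form is additive in the left factor and therefore holds
  for every polynomial.
\<close>

lemma d_scalar: "d (ext_scalar p * a) = d (ext_scalar p) * a + ext_scalar p * d a"
proof (induction p arbitrary: a rule: poly3_induct)
  case (add p q)
  then show ?case by (simp add: ext_scalar_hom algebra_simps)
next
  case (cst c)
  then show ?case using d_const[of c] d_const_mult[of c a] by (simp add: const_eq)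
next
  case (var i q)
  have "d (ext_scalar (var i * q) * a) = d (gen_y i * (ext_scalar q * a))"
    by (simp add: gen_y_eq ext_scalar_hom mult.assoc)
  also have "\<dots> = d (gen_y i) * (ext_scalar q * a) + gen_y i * (d (ext_scalar q) * a + ext_scalar q * d a)"
    by (simp add: d_gen_y var)
  also have "\<dots> = d (gen_y i * ext_scalar q) * a + gen_y i * ext_scalar q * d a"
    by (simp add: d_gen_y algebra_simps)
  finally show ?case by (simp add: gen_y_eq ext_scalar_hom)
qed

lemma d_scalar_power:
  "d (ext_scalar (p ^ Suc n)) = ext_scalar (of_nat (Suc n) * p ^ n) * d (ext_scalar p)"
proof (induction n)
  case (Suc n)
  have "d (ext_scalar (p ^ Suc (Suc n))) = d (ext_scalar p * ext_scalar (p ^ Suc n))"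
    by (simp add: ext_scalar_hom)
  also have "\<dots> = ext_scalar (p ^ Suc n) * d (ext_scalar p)
      + ext_scalar p * (ext_scalar (of_nat (Suc n) * p ^ n) * d (ext_scalar p))"
    unfolding d_scalar Suc ext_scalar_central[of "p ^ Suc n"] ..
  also have "\<dots> = ext_scalar (p ^ Suc n + p * (of_nat (Suc n) * p ^ n)) * d (ext_scalar p)"
    by (simp only: ext_scalar_hom distrib_right mult.assoc)
  also have "p ^ Suc n + p * (of_nat (Suc n) * p ^ n) = of_nat (Suc (Suc n)) * p ^ Suc n"
    by (simp add: algebra_simps)
  finally show ?case .
qed simp

end

section \<open>The Koszul complex\<close>

lemma ext_scalar_eq_0_iff [simp]: "ext_scalar p = 0 \<longleftrightarrow> p = 0"
  using ext_scalar_eq_iff[of p 0] by simp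

lemma less_3: "(3::3) < 1" "(1::3) < 2" "(3::3) < 2"
  by (simp_all add: less_bit1_def bit1.Rep_numeral bit1.Rep_1)

definition vol :: "'k::field E0" where
  "vol = gen_x 1 * (gen_x 2 * gen_x 3)"

definition form1 :: "'k::field poly3 \<Rightarrow> 'k poly3 \<Rightarrow> 'k poly3 \<Rightarrow> 'k E0" where
  "form1 p q r = ext_scalar p * gen_x 1 + ext_scalar q * gen_x 2 + ext_scalar r * gen_x 3"

text \<open>
  In the cyclic order of the two-forms, the Koszul differential is the cross product with
  \<open>(y\<^sub>1, y\<^sub>2, y\<^sub>3)\<close> on two-forms and the scalar product with it on one-forms.
\<close>

definition form2 :: "'k::field poly3 \<Rightarrow> 'k poly3 \<Rightarrow> 'k poly3 \<Rightarrow> 'k E0" where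
  "form2 p q r = ext_scalar p * (gen_x 2 * gen_x 3) + ext_scalar q * (gen_x 3 * gen_x 1)
     + ext_scalar r * (gen_x 1 * gen_x 2)"

lemma gen_x_mult_gen_x_mult: "gen_x i * (gen_x i * a) = 0"
  by (simp add: gen_x_square flip: mult.assoc)

lemma gen_x_reorder: "gen_x i * (gen_x j * a) = - (gen_x j * (gen_x i * a))"
  using arg_cong[OF gen_x_anticommute[of i j], of "\<lambda>b. b * a"] by (simp add: mult.assoc)

lemma vol_eq_monomial: "vol = ext_monomial UNIV"
proof -
  have "gen_x 2 = (ext_monomial {2} :: 'a E0)"
    using ext_monomial_insert[of "{}" 2, where 'k = 'a] by (simp add: ext_monomial_empty)
  then have "gen_x 1 * gen_x 2 = (ext_monomial {1, 2} :: 'a E0)"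
    using ext_monomial_insert[of "{2}" 1, where 'k = 'a] less_3 by simp
  moreover have "\<And>j. j \<in> {1, 2} \<Longrightarrow> (3 :: 3) < j" using less_3 by auto
  ultimately have "gen_x 3 * (gen_x 1 * gen_x 2) = (ext_monomial {3, 1, 2} :: 'a E0)"
    using ext_monomial_insert[of "{1, 2}" 3, where 'k = 'a] by metis
  \<comment> \<open>The least element of the index type is 3 = 0; moving it to the end is an even permutation.\<close>
  moreover have "{3, 1, 2} = (UNIV :: 3 set)" unfolding UNIV_3 by auto
  moreover have "gen_x 3 * (gen_x 1 * gen_x 2) = (vol :: 'a E0)"
    unfolding vol_def gen_x_reorder[of 3 1] gen_x_reorder[of 3 2] gen_x_anticommute[of 3 2] by simp
  ultimately show ?thesis by simp
qed

lemma scalar_vol_eq_0: "ext_scalar p * vol = 0 \<longleftrightarrow> p = 0"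
proof
  assume "ext_scalar p * vol = 0"
  then have "ext_coeff (ext_scalar p * vol) UNIV = 0" by simp
  then show "p = 0" by (simp add: ext_scalar_mult vol_eq_monomial ext_coeff_monomial)
qed simp

lemma form1_add: "form1 p q r + form1 p' q' r' = form1 (p + p') (q + q') (r + r')"
  by (simp add: form1_def ext_scalar_hom algebra_simps)

lemma form2_add: "form2 p q r + form2 p' q' r' = form2 (p + p') (q + q') (r + r')"
  by (simp add: form2_def ext_scalar_hom algebra_simps)

lemma form1_eq_0_iff: "form1 p q r = 0 \<longleftrightarrow> p = 0 \<and> q = 0 \<and> r = 0"
proof
  assume *: "form1 p q r = 0"
  have "ext_coeff (form1 p q r) {1} = p" "ext_coeff (form1 p q r) {2} = q" "ext_coeff (form1 p q r) {3} = r"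
    by (simp_all add: form1_def ext_scalar_mult gen_x_def ext_coeff_gen)
  then show "p = 0 \<and> q = 0 \<and> r = 0" using * by simp
qed (simp add: form1_def)

lemma form2_eq_0_iff: "form2 p q r = 0 \<longleftrightarrow> p = 0 \<and> q = 0 \<and> r = 0"
proof
  assume *: "form2 p q r = 0"
  have "gen_x 1 * form2 p q r = ext_scalar p * vol" "gen_x 2 * form2 p q r = ext_scalar q * vol"
    "gen_x 3 * form2 p q r = ext_scalar r * vol"
    unfolding form2_def vol_def
    by (simp_all add: distrib_left right_diff_distrib gen_x_scalar gen_x_square gen_x_mult_gen_x_mult
        gen_x_reorder[of 2 1] gen_x_reorder[of 3 1] gen_x_reorder[of 3 2] gen_x_anticommute[of 3 2] gen_x_anticommute[of 3 1])
  then show "p = 0 \<and> q = 0 \<and> r = 0" using * by (simp add: scalar_vol_eq_0)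
qed (simp add: form2_def)

lemma scalar_gen_x_in: "p \<in> homogeneous s \<Longrightarrow> ext_scalar p * gen_x i \<in> E0_part s 1"
  by (rule E0_part_scalar_mult[OF _ E0_part_gen_x, unfolded add_0_right])

lemma form1_in: "p \<in> homogeneous s \<Longrightarrow> q \<in> homogeneous s \<Longrightarrow> r \<in> homogeneous s \<Longrightarrow> form1 p q r \<in> E0_part s 1"
  unfolding form1_def by (intro E0_part_add scalar_gen_x_in)

lemma gen_x2_in: "gen_x i * gen_x j \<in> E0_part 0 2"
  using E0_part_mult[OF E0_part_gen_x E0_part_gen_x, of i j] by (simp only: one_add_one add_0_right)

lemma scalar_gen_x2_in: "p \<in> homogeneous s \<Longrightarrow> ext_scalar p * (gen_x i * gen_x j) \<in> E0_part s 2"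
  by (rule E0_part_scalar_mult[OF _ gen_x2_in, unfolded add_0_right])

lemma form2_in: "p \<in> homogeneous s \<Longrightarrow> q \<in> homogeneous s \<Longrightarrow> r \<in> homogeneous s \<Longrightarrow> form2 p q r \<in> E0_part s 2"
  unfolding form2_def by (intro E0_part_add scalar_gen_x2_in)

lemma vol_in: "p \<in> homogeneous s \<Longrightarrow> ext_scalar p * vol \<in> E0_part s 3"
  unfolding vol_def
  by (rule E0_part_scalar_mult[OF _ E0_part_mult[OF E0_part_gen_x gen_x2_in], unfolded add_0_right one_plus_numeral semiring_norm(3)])

text \<open>
  The four exterior degrees are treated together because multiplication by a generator \<open>x\<^sub>i\<close> raises
  the exterior degree in the induction.
\<close>

lemma E0_part_shapes:
  fixes a :: "'k::field E0"
  assumes "a \<in> E0_part s t"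
  shows "(t = 0 \<longrightarrow> (\<exists>p\<in>homogeneous s. a = ext_scalar p)) \<and>
    (t = 1 \<longrightarrow> (\<exists>p\<in>homogeneous s. \<exists>q\<in>homogeneous s. \<exists>r\<in>homogeneous s. a = form1 p q r)) \<and>
    (t = 2 \<longrightarrow> (\<exists>p\<in>homogeneous s. \<exists>q\<in>homogeneous s. \<exists>r\<in>homogeneous s. a = form2 p q r)) \<and>
    (t = 3 \<longrightarrow> (\<exists>p\<in>homogeneous s. a = ext_scalar p * vol))"
  using assms
proof (induction rule: E0_part_induct)
  case (zero s t)
  have "form1 0 0 0 = (0 :: 'k E0)" "form2 0 0 0 = (0 :: 'k E0)" by (simp_all add: form1_def form2_def)
  then show ?case by (intro conjI impI bexI[of _ 0]) simp_all
next
  case (add s t a b)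
  show ?case
  proof (intro conjI impI)
    assume "t = 0"
    then show "\<exists>p\<in>homogeneous s. a + b = ext_scalar p"
      using add by (metis ext_scalar_hom(1) homogeneous_add)
  next
    assume "t = 1"
    from add[THEN conjunct2, THEN conjunct1, rule_format, OF this]
    obtain p q r p' q' r' where h: "p \<in> homogeneous s" "q \<in> homogeneous s" "r \<in> homogeneous s"
      "p' \<in> homogeneous s" "q' \<in> homogeneous s" "r' \<in> homogeneous s"
      and ab: "a = form1 p q r" "b = form1 p' q' r'" by (elim bexE)
    show "\<exists>p\<in>homogeneous s. \<exists>q\<in>homogeneous s. \<exists>r\<in>homogeneous s. a + b = form1 p q r"
      unfolding ab form1_add using h homogeneous_add by blast
  next
    assume "t = 2"
    from add[THEN conjunct2, THEN conjunct2, THEN conjunct1, rule_format, OF this]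
    obtain p q r p' q' r' where h: "p \<in> homogeneous s" "q \<in> homogeneous s" "r \<in> homogeneous s"
      "p' \<in> homogeneous s" "q' \<in> homogeneous s" "r' \<in> homogeneous s"
      and ab: "a = form2 p q r" "b = form2 p' q' r'" by (elim bexE)
    show "\<exists>p\<in>homogeneous s. \<exists>q\<in>homogeneous s. \<exists>r\<in>homogeneous s. a + b = form2 p q r"
      unfolding ab form2_add using h homogeneous_add by blast
  next
    assume "t = 3"
    then show "\<exists>p\<in>homogeneous s. a + b = ext_scalar p * vol"
      using add by (auto simp flip: distrib_right ext_scalar_hom(1) intro: homogeneous_add)
  qed
next
  case (const c)
  then show ?case by (auto simp: const_eq homogeneous_cst)
next
  case (gen_x s t i a)
  have i: "i = 1 \<or> i = 2 \<or> i = 3" by (rule exhaust_3)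
  show ?case
  proof (intro conjI impI)
    assume "Suc t = 1"
    then obtain p where p: "p \<in> homogeneous s" "a = ext_scalar p" using gen_x by auto
    have "gen_x i * a = form1 (if i = 1 then p else 0) (if i = 2 then p else 0) (if i = 3 then p else 0)"
      using i by (auto simp: p form1_def gen_x_scalar)
    then show "\<exists>p\<in>homogeneous s. \<exists>q\<in>homogeneous s. \<exists>r\<in>homogeneous s. gen_x i * a = form1 p q r"
      using p(1) by - (rule bexI, rule bexI, rule bexI, assumption, auto)
  next
    assume "Suc t = 2"
    then obtain p q r where p: "p \<in> homogeneous s" "q \<in> homogeneous s" "r \<in> homogeneous s" "a = form1 p q r"
      using gen_x by auto
    have "gen_x 1 * a = form2 0 (- r) q" "gen_x 2 * a = form2 r 0 (- p)" "gen_x 3 * a = form2 (- q) p 0"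
      by (simp_all add: p form1_def form2_def distrib_left right_diff_distrib gen_x_scalar gen_x_square
          gen_x_anticommute[of 2 1] gen_x_anticommute[of 3 2] gen_x_anticommute[of 1 3])
    then show "\<exists>p\<in>homogeneous s. \<exists>q\<in>homogeneous s. \<exists>r\<in>homogeneous s. gen_x i * a = form2 p q r"
      using i p(1,2,3) by (elim disjE; simp only:; blast intro: homogeneous_0 homogeneous_uminus)
  next
    assume "Suc t = 3"
    then obtain p q r where p: "p \<in> homogeneous s" "q \<in> homogeneous s" "r \<in> homogeneous s" "a = form2 p q r"
      using gen_x by auto
    have "gen_x 1 * a = ext_scalar p * vol" "gen_x 2 * a = ext_scalar q * vol" "gen_x 3 * a = ext_scalar r * vol"
      by (simp_all add: p form2_def vol_def distrib_left right_diff_distrib gen_x_scalar gen_x_square gen_x_mult_gen_x_mult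
        gen_x_reorder[of 2 1] gen_x_reorder[of 3 1] gen_x_reorder[of 3 2] gen_x_anticommute[of 3 2] gen_x_anticommute[of 3 1])
    then show "\<exists>p\<in>homogeneous s. gen_x i * a = ext_scalar p * vol"
      using i p(1,2,3) by (elim disjE; simp only:; blast)
  qed simp
next
  case (gen_y s t i a)
  have y: "gen_y i * form1 p q r = form1 (var i * p) (var i * q) (var i * r)"
    "gen_y i * form2 p q r = form2 (var i * p) (var i * q) (var i * r)"
    "gen_y i * (ext_scalar p * vol) = ext_scalar (var i * p) * vol"
    "gen_y i * ext_scalar p = ext_scalar (var i * p)" for p q r
    by (simp_all add: form1_def form2_def gen_y_eq ext_scalar_hom distrib_left mult.assoc)
  show ?case
  proof (intro conjI impI)
    assume "t = 0"
    then obtain p where p: "p \<in> homogeneous s" "a = ext_scalar p" using gen_y by auto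
    show "\<exists>p\<in>homogeneous (Suc s). gen_y i * a = ext_scalar p"
      unfolding p(2) y using p(1)[THEN homogeneous_var_mult] by blast
  next
    assume "t = 1"
    then obtain p q r where p: "p \<in> homogeneous s" "q \<in> homogeneous s" "r \<in> homogeneous s" "a = form1 p q r"
      using gen_y by auto
    show "\<exists>p\<in>homogeneous (Suc s). \<exists>q\<in>homogeneous (Suc s). \<exists>r\<in>homogeneous (Suc s). gen_y i * a = form1 p q r"
      unfolding p(4) y using p(1-3)[THEN homogeneous_var_mult] by blast
  next
    assume "t = 2"
    then obtain p q r where p: "p \<in> homogeneous s" "q \<in> homogeneous s" "r \<in> homogeneous s" "a = form2 p q r"
      using gen_y by auto
    show "\<exists>p\<in>homogeneous (Suc s). \<exists>q\<in>homogeneous (Suc s). \<exists>r\<in>homogeneous (Suc s). gen_y i * a = form2 p q r"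
      unfolding p(4) y using p(1-3)[THEN homogeneous_var_mult] by blast
  next
    assume "t = 3"
    then obtain p where p: "p \<in> homogeneous s" "a = ext_scalar p * vol" using gen_y by auto
    show "\<exists>p\<in>homogeneous (Suc s). gen_y i * a = ext_scalar p * vol"
      unfolding p(2) y using p(1)[THEN homogeneous_var_mult] by blast
  qed
qed

lemma E0_part_1E:
  assumes "a \<in> E0_part s 1"
  obtains p q r where "p \<in> homogeneous s" "q \<in> homogeneous s" "r \<in> homogeneous s" "a = form1 p q r"
  using E0_part_shapes[OF assms] by auto

lemma E0_part_2E:
  assumes "a \<in> E0_part s 2"
  obtains p q r where "p \<in> homogeneous s" "q \<in> homogeneous s" "r \<in> homogeneous s" "a = form2 p q r"
  using E0_part_shapes[OF assms] by auto

lemma E0_part_3E: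
  assumes "a \<in> E0_part s 3"
  obtains p where "p \<in> homogeneous s" "a = ext_scalar p * vol"
  using E0_part_shapes[OF assms] by auto

locale koszul = derivation d for d :: "'k::field E0 \<Rightarrow> 'k E0" +
  assumes d_x: "d (gen_x l) = gen_y l" and d_y: "d (gen_y l) = 0"
begin

lemma d_scalar_0 [simp]: "d (ext_scalar p) = 0"
proof (induction p rule: poly3_induct)
  case (var i q)
  then show ?case using d_gen_y[of i "ext_scalar q"] by (simp add: gen_y_eq[symmetric] d_y ext_scalar_hom)
qed (simp_all add: ext_scalar_hom flip: const_eq)

lemma d_scalar_mult: "d (ext_scalar p * a) = ext_scalar p * d a"
  using d_scalar[of p a] by simp

lemma d_x_mult: "d (gen_x i * gen_x j) = ext_scalar (var i) * gen_x j - ext_scalar (var j) * gen_x i"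
  by (simp add: d_gen_x d_x gen_y_eq gen_x_scalar)

lemma d_form1: "d (form1 p q r) = ext_scalar (p * var 1 + q * var 2 + r * var 3)"
  by (simp add: form1_def d_scalar_mult d_x gen_y_eq ext_scalar_hom)

lemma d_form2:
  "d (form2 p q r) = form1 (q * var 3 - r * var 2) (r * var 1 - p * var 3) (p * var 2 - q * var 1)"
  by (simp add: form1_def form2_def d_scalar_mult d_x_mult ext_scalar_hom ext_scalar_diff algebra_simps)

lemma d_vol: "d (ext_scalar p * vol) = form2 (p * var 1) (p * var 2) (p * var 3)"
proof -
  have "d vol = ext_scalar (var 1) * (gen_x 2 * gen_x 3) - gen_x 1 * (ext_scalar (var 2) * gen_x 3 - ext_scalar (var 3) * gen_x 2)"
    by (simp add: vol_def d_gen_x[of 1] d_x_mult d_x gen_y_eq)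
  also have "\<dots> = ext_scalar (var 1) * (gen_x 2 * gen_x 3) + ext_scalar (var 2) * (gen_x 3 * gen_x 1)
     + ext_scalar (var 3) * (gen_x 1 * gen_x 2)"
    by (simp add: gen_x_scalar right_diff_distrib gen_x_anticommute[of 3 1])
  finally show ?thesis
    by (simp add: form2_def d_scalar_mult ext_scalar_merge distrib_left)
qed

lemma d_part:
  assumes "a \<in> E0_part s (Suc t)"
  shows "d a \<in> E0_part (Suc s) t"
proof -
  have hom: "p * var i \<in> homogeneous (Suc s)" if "p \<in> homogeneous s" for p :: "'k poly3" and i s
    using homogeneous_var_mult[OF that, of i] by (simp only: mult.commute)
  consider "t = 0" | "t = 1" | "t = 2" | "Suc t > 3" by linarith
  then show ?thesis
  proof cases
    case 1
    then have "a \<in> E0_part s 1" using assms by simp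
    then show ?thesis
      by (rule E0_part_1E) (simp only: 1 d_form1 E0_part_scalar homogeneous_add hom)
  next
    case 2
    then have "a \<in> E0_part s 2" using assms by (simp only: Suc_1)
    then show ?thesis
      by (rule E0_part_2E) (simp only: 2 d_form2 form1_in homogeneous_diff hom)
  next
    case 3
    then have "a \<in> E0_part s 3" using assms by (simp only: numeral_3_eq_3 numeral_2_eq_2)
    then show ?thesis
      by (rule E0_part_3E) (simp only: 3 d_vol form2_in hom)
  next
    case 4
    then show ?thesis using E0_part_gt_3[OF assms] by simp
  qed
qed

lemma exact_3: "a \<in> E0_part s 3 \<Longrightarrow> d a = 0 \<Longrightarrow> a = 0"
  by (auto elim!: E0_part_3E simp: d_vol form2_eq_0_iff)

text \<open>
  A field of coefficients parallel to \<open>(y\<^sub>1, y\<^sub>2, y\<^sub>3)\<close> is a polynomial multiple of it, because the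
  first coefficient is divisible by the prime \<open>y\<^sub>1\<close>.
\<close>

lemma exact_2:
  assumes "a \<in> E0_part (Suc s) 2" "d a = 0"
  shows "\<exists>b\<in>E0_part s 3. d b = a"
proof -
  obtain p q r where h: "p \<in> homogeneous (Suc s)" and a: "a = form2 p q r"
    using assms(1) by (rule E0_part_2E)
  have eq: "q * var 3 = r * var 2" "r * var 1 = p * var 3" "p * var 2 = q * var 1"
    using assms(2) by (simp_all add: a d_form2 form1_eq_0_iff)
  have "var 1 dvd var 2 * p" by (simp add: mult.commute[of "var 2"] eq)
  then obtain f where f: "p = var 1 * f" using var_dvd_var_mult[of 1 2 p] by auto
  have "q = f * var 2" "r = f * var 3"
    using eq by (simp_all add: f mult_ac)
  moreover have "f \<in> homogeneous s" using h homogeneous_var_cancel f by metis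
  ultimately show ?thesis using vol_in d_vol[of f] a f by (metis mult.commute)
qed

text \<open>
  This is the regularity of the sequence \<open>y\<^sub>3, y\<^sub>2, y\<^sub>1\<close>.  Modulo \<open>y\<^sub>3\<close> a relation
  \<open>p y\<^sub>1 + q y\<^sub>2 + r y\<^sub>3 = 0\<close> becomes a relation between \<open>y\<^sub>1\<close> and \<open>y\<^sub>2\<close> alone, which is a multiple of
  the trivial one; the corrections of \<open>p\<close> and \<open>q\<close> by multiples of \<open>y\<^sub>3\<close> then determine \<open>r\<close>.
\<close>

lemma exact_1:
  assumes "a \<in> E0_part (Suc s) 1" "d a = 0"
  shows "\<exists>b\<in>E0_part s 2. d b = a"
proof -
  obtain p q r where h: "p \<in> homogeneous (Suc s)" "q \<in> homogeneous (Suc s)" and a: "a = form1 p q r"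
    using assms(1) by (rule E0_part_1E)
  have eq: "p * var 1 + q * var 2 + r * var 3 = 0"
    using assms(2) by (simp add: a d_form1)
  then have "kill 3 (p * var 1 + q * var 2 + r * var 3) = 0" by simp
  then have k: "kill 3 p * var 1 = - (kill 3 q * var 2)" by (simp add: eq_neg_iff_add_eq_0)
  then have "var 2 dvd var 1 * kill 3 p" by (simp add: mult.commute[of "var 1"])
  then obtain g where g: "kill 3 p = var 2 * g" using var_dvd_var_mult[of 2 1] by auto
  have q: "kill 3 q = - (var 1 * g)"
  proof -
    have "(kill 3 q + var 1 * g) * var 2 = 0" using k by (simp add: g algebra_simps)
    then show ?thesis by (simp add: eq_neg_iff_add_eq_0)
  qed
  obtain A where A: "p - kill 3 p = var 3 * A" using var_dvd_minus_kill by blast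
  obtain B where B: "q - kill 3 q = var 3 * B" using var_dvd_minus_kill by blast
  have p': "p = var 2 * g + var 3 * A" and q': "q = - (var 1 * g) + var 3 * B"
    using A B g q by (simp_all add: algebra_simps)
  have "var 3 * (r + A * var 1 + B * var 2) = 0" using eq by (simp add: p' q' algebra_simps)
  then have "r + A * var 1 + B * var 2 = 0" by simp
  moreover have "r = (r + A * var 1 + B * var 2) - B * var 2 - A * var 1" by simp
  ultimately have r: "r = - (B * var 2) - A * var 1" by simp
  have "g \<in> homogeneous s" "A \<in> homogeneous s" "B \<in> homogeneous s"
    using h homogeneous_kill homogeneous_diff A B g homogeneous_var_cancel by metis+
  then have "form2 (- B) A (- g) \<in> E0_part s 2" by (intro form2_in homogeneous_uminus)
  moreover have "d (form2 (- B) A (- g)) = a"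
    by (simp add: d_form2 a p' q' r algebra_simps)
  ultimately show ?thesis by blast
qed

lemma exact_0:
  assumes "a \<in> E0_part (Suc s) 0"
  shows "\<exists>b\<in>E0_part s 1. d b = a"
proof -
  have "p \<in> homogeneous s \<and> (s = 0 \<or> (\<exists>b\<in>E0_part (s - 1) 1. d b = ext_scalar p))"
    if "p \<in> homogeneous s" for p s
    using that
  proof (induction rule: homogeneous_induct)
    case (zero s)
    then show ?case by (metis E0_part_0 d_0 ext_scalar_simps(1) homogeneous_0)
  next
    case (add s p q)
    then show ?case by (metis E0_part_add d_add ext_scalar_hom(1) homogeneous_add)
  next
    case (cst c)
    then show ?case by (simp add: homogeneous_cst)
  next
    case (var s i q)
    have "ext_scalar q * gen_x i \<in> E0_part s 1"
      using scalar_gen_x_in var by blast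
    moreover have "d (ext_scalar q * gen_x i) = ext_scalar (var i * q)"
      by (simp add: d_scalar_mult d_x gen_y_eq mult.commute[of "var i"] ext_scalar_hom)
    ultimately show ?case using var homogeneous_var_mult diff_Suc_1 by metis
  qed
  then show ?thesis using assms by (metis E0_part_zeroE diff_Suc_1 nat.distinct(1))
qed

end

section \<open>The differential in matrix coordinates\<close>

definition lin :: "(3 \<Rightarrow> 'k::field) \<Rightarrow> 'k poly3" where
  "lin a = (\<Sum>i\<in>UNIV. cst (a i) * var i)"

definition lin_x :: "(3 \<Rightarrow> 'k::field) \<Rightarrow> 'k E0" where
  "lin_x a = (\<Sum>i\<in>UNIV. const (a i) * gen_x i)"

lemma homogeneous_lin: "lin a \<in> homogeneous 1"
  unfolding lin_def by (intro homogeneous_sum homogeneous_cst_mult homogeneous_var)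

lemma lin_x_in: "lin_x a \<in> E0_part 0 1"
  unfolding lin_x_def by (intro E0_part_sum E0_part_const_mult E0_part_gen_x)

lemma less_pairs_3: "{(j, k). j < (k::3)} = {(3, 1), (3, 2), (1, 2)}"
proof -
  have "j < k \<longleftrightarrow> (j, k) \<in> {(3, 1), (3, 2), (1, 2)}" for j k :: 3
    using exhaust_3[of j] exhaust_3[of k]
    by (elim disjE) (simp_all add: less_bit1_def bit1.Rep_numeral bit1.Rep_1)
  then show ?thesis by auto
qed

definition two_form :: "(3 \<Rightarrow> 3 \<Rightarrow> 'k::field) \<Rightarrow> 'k E0" where
  "two_form f = (\<Sum>(j, k)\<in>{(j, k). j < k}. const (f j k) * gen_x j * gen_x k)"

lemma two_form_eq: "two_form f = ext_scalar (cst (f 3 1)) * (gen_x 3 * gen_x 1)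
   + ext_scalar (cst (f 3 2)) * (gen_x 3 * gen_x 2) + ext_scalar (cst (f 1 2)) * (gen_x 1 * gen_x 2)"
  by (simp add: two_form_def less_pairs_3 const_eq mult.assoc add.assoc)

lemma two_form_add: "two_form (\<lambda>j k. f j k + g j k) = two_form f + two_form g"
  by (simp add: two_form_eq ext_scalar_hom algebra_simps)

lemma two_form_scale: "two_form (\<lambda>j k. a * f j k) = const a * two_form f"
  by (simp add: two_form_eq const_eq ext_scalar_hom distrib_left mult.assoc)

lemma lin_x_mult: "lin_x a * lin_x b = two_form (\<lambda>j k. a j * b k - b j * a k)"
  unfolding two_form_eq lin_x_def sum_3 const_eq
  by (simp add: distrib_left distrib_right mult.assoc gen_x_scalar ext_scalar_merge gen_x_square
      ext_scalar_diff left_diff_distrib gen_x_anticommute[of 2 1] gen_x_anticommute[of 2 3]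
      gen_x_anticommute[of 1 3] mult.commute[of "cst (b _)"])

lemma lin_x_square: "lin_x a * lin_x a = 0"
  unfolding lin_x_mult by (simp add: two_form_def const_eq)

lemma lin_x_anticommute: "lin_x a * lin_x b = - (lin_x b * lin_x a)"
  unfolding lin_x_mult by (simp add: two_form_eq left_diff_distrib ext_scalar_diff)

lemma lin_x_mult_lin_x_mult: "lin_x a * (lin_x a * z) = 0"
  using arg_cong[OF lin_x_square[of a], of "\<lambda>b. b * z"] by (simp add: mult.assoc)

lemma lin_x_reorder: "lin_x a * (lin_x b * z) = - (lin_x b * (lin_x a * z))"
  using arg_cong[OF lin_x_anticommute[of a b], of "\<lambda>b. b * z"] by (simp add: mult.assoc)

lemma lin_lin_x_mult:
  "ext_scalar (lin a) * lin_x b = (\<Sum>j\<in>UNIV. \<Sum>k\<in>UNIV. const (a j * b k) * gen_y j * gen_x k)"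
  unfolding lin_x_def lin_def sum_3 const_eq gen_y_eq
  by (simp add: distrib_left distrib_right ext_scalar_hom mult.assoc)
     (simp add: ext_scalar_merge mult_ac add_ac)

locale sl2_complex = derivation d0 for d0 :: "'k::field E0 \<Rightarrow> 'k E0" +
  fixes e :: "3 \<Rightarrow> 'k^2^2" and c :: "3 \<Rightarrow> 3 \<Rightarrow> 3 \<Rightarrow> 'k"
  assumes basis: "sl2_basis e"
    and brackets: "bracket (e j) (e k) = (\<Sum>l\<in>UNIV. mat_scale (c j k l) (e l))"
    and d0_x: "d0 (gen_x l) = - (\<Sum>(j, k)\<in>{(j, k). j < k}. const (c j k l) * gen_x j * gen_x k)"
    and d0_y: "d0 (gen_y l) = (\<Sum>j\<in>UNIV. \<Sum>k\<in>UNIV. const (c j k l) * gen_y j * gen_x k)"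
begin

text \<open>
  Row \<open>a\<close> holds one matrix entry of the three basis elements: the entries (1,2), (2,1), (1,1) for
  \<open>a = 1, 2, 3\<close>.  With them the generic element \<open>r = \<Sum>\<^sub>j y\<^sub>j e\<^sub>j\<close> is the matrix with rows \<open>(Z, X)\<close> and
  \<open>(Y, -Z)\<close>, and the one-form \<open>\<omega> = \<Sum>\<^sub>j x\<^sub>j e\<^sub>j\<close> is the matrix with rows \<open>(Zeta, Xi)\<close> and
  \<open>(Eta, -Zeta)\<close>.
\<close>

definition coord :: "3 \<Rightarrow> 3 \<Rightarrow> 'k" where
  "coord a j = (if a = 1 then e j $ 1 $ 2 else if a = 2 then e j $ 2 $ 1 else e j $ 1 $ 1)"

text \<open>
  The basis spans the three matrices that are dual to the chosen entries, which gives a right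
  inverse of the square matrix \<open>coord\<close>; over a field it is also a left inverse.
\<close>

lemma coord_inverse_ex:
  "\<exists>N. (\<forall>a b. (\<Sum>i\<in>UNIV. coord a i * N i b) = (if a = b then 1 else 0)) \<and>
       (\<forall>i j. (\<Sum>a\<in>UNIV. N i a * coord a j) = (if i = j then 1 else 0))"
proof -
  have inj: "inj e" and span: "mat.span (range e) = sl2"
    using basis by (auto simp: sl2_basis_def)
  have comb: "\<exists>u. A = (\<Sum>i\<in>UNIV. mat_scale (u i) (e i))" if "A \<in> sl2" for A
  proof -
    have "A \<in> mat.span (range e)" using that span by simp
    then obtain u where "A = (\<Sum>v\<in>range e. mat_scale (u v) v)"
      by (auto simp: mat.span_finite)
    then have "A = (\<Sum>i\<in>UNIV. mat_scale (u (e i)) (e i))"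
      by (simp add: sum.reindex[OF inj])
    then show ?thesis by (rule exI[of _ "\<lambda>i. u (e i)"])
  qed
  define S :: "3 \<Rightarrow> 'k^2^2" where
    "S b = (\<chi> i j. if b = 1 then (if i = 1 \<and> j = 2 then 1 else 0)
       else if b = 2 then (if i = 2 \<and> j = 1 then 1 else 0)
       else (if i = j then (if i = 1 then 1 else - 1) else 0))" for b
  have "S b \<in> sl2" for b by (simp add: S_def sl2_def trace_def sum_2)
  then have "\<forall>b. \<exists>u. S b = (\<Sum>i\<in>UNIV. mat_scale (u i) (e i))" using comb by blast
  then obtain N where N: "\<forall>b. S b = (\<Sum>i\<in>UNIV. mat_scale (N b i) (e i))"
    by (rule choice[THEN exE])
  have ent: "S b $ r $ s = (\<Sum>i\<in>UNIV. N b i * e i $ r $ s)" for b r s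
    using N by (simp add: mat_scale_def)
  have 1: "(\<Sum>i\<in>UNIV. coord a i * N b i) = (if a = b then 1 else 0)" for a b
    using ent[of b 1 2] ent[of b 2 1] ent[of b 1 1] exhaust_3[of a] exhaust_3[of b]
    by (auto simp: coord_def S_def mult.commute[of _ "N _ _"])
  define A :: "'k^3^3" where "A = (\<chi> a i. coord a i)"
  define B :: "'k^3^3" where "B = (\<chi> i b. N b i)"
  have "A ** B = mat 1"
    by (simp add: A_def B_def matrix_matrix_mult_def mat_def vec_eq_iff 1)
  then have "B ** A = mat 1" by (rule matrix_left_right_inverse1)
  then have "(\<Sum>a\<in>UNIV. N a i * coord a j) = (if i = j then 1 else 0)" for i j
    by (simp add: A_def B_def matrix_matrix_mult_def mat_def vec_eq_iff)
  with 1 show ?thesis by (intro exI[of _ "\<lambda>i b. N b i"]) simp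
qed

definition icoord :: "3 \<Rightarrow> 3 \<Rightarrow> 'k" where
  "icoord = (SOME N. (\<forall>a b. (\<Sum>i\<in>UNIV. coord a i * N i b) = (if a = b then 1 else 0)) \<and>
       (\<forall>i j. (\<Sum>a\<in>UNIV. N i a * coord a j) = (if i = j then 1 else 0)))"

lemma icoord_right: "(\<Sum>i\<in>UNIV. coord a i * icoord i b) = (if a = b then 1 else 0)"
  and icoord_left: "(\<Sum>a\<in>UNIV. icoord i a * coord a j) = (if i = j then 1 else 0)"
  using someI_ex[OF coord_inverse_ex] unfolding icoord_def by blast+

lemma gen_x_eq_lin: "gen_x j = (\<Sum>a\<in>UNIV. const (icoord j a) * lin_x (coord a))"
proof -
  have "(\<Sum>a\<in>UNIV. const (icoord j a) * lin_x (coord a))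
      = (\<Sum>i\<in>UNIV. \<Sum>a\<in>UNIV. const (icoord j a * coord a i) * gen_x i)"
    unfolding lin_x_def sum_distrib_left
    by (subst sum.swap) (simp add: const_eq ext_scalar_hom mult.assoc)
  also have "\<dots> = (\<Sum>i\<in>UNIV. const (\<Sum>a\<in>UNIV. icoord j a * coord a i) * gen_x i)"
    by (simp add: sum_3 const_eq ext_scalar_hom distrib_right)
  also have "\<dots> = (\<Sum>i\<in>UNIV. if i = j then gen_x i else 0)"
    unfolding icoord_left by (intro sum.cong) (auto simp: const_eq)
  finally show ?thesis by simp
qed

lemma var_eq_lin: "var j = (\<Sum>a\<in>UNIV. cst (icoord j a) * lin (coord a))"
proof -
  have "(\<Sum>a\<in>UNIV. cst (icoord j a) * lin (coord a))
      = (\<Sum>i\<in>UNIV. \<Sum>a\<in>UNIV. cst (icoord j a * coord a i) * var i)"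
    unfolding lin_def sum_distrib_left
    by (subst sum.swap) (simp add: mult.assoc)
  also have "\<dots> = (\<Sum>i\<in>UNIV. cst (\<Sum>a\<in>UNIV. icoord j a * coord a i) * var i)"
    by (simp add: sum_3 distrib_right)
  also have "\<dots> = (\<Sum>i\<in>UNIV. if i = j then var i else 0)"
    unfolding icoord_left by (intro sum.cong) auto
  finally show ?thesis by simp
qed

abbreviation "X \<equiv> lin (coord 1)"
abbreviation "Y \<equiv> lin (coord 2)"
abbreviation "Z \<equiv> lin (coord 3)"
abbreviation "Xi \<equiv> lin_x (coord 1)"
abbreviation "Eta \<equiv> lin_x (coord 2)"
abbreviation "Zeta \<equiv> lin_x (coord 3)"

lemma d0_lin_x: "d0 (lin_x a) = - two_form (\<lambda>j k. \<Sum>l\<in>UNIV. a l * c j k l)"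
  unfolding lin_x_def sum_3 two_form_def[symmetric] d0_x[unfolded two_form_def[symmetric]] d_add d_const_mult
  by (simp add: two_form_add two_form_scale d0_x[unfolded two_form_def[symmetric]])

lemma d0_lin: "d0 (ext_scalar (lin a)) = (\<Sum>j\<in>UNIV. \<Sum>k\<in>UNIV. const (\<Sum>l\<in>UNIV. a l * c j k l) * gen_y j * gen_x k)"
proof -
  have "ext_scalar (lin a) = (\<Sum>l\<in>UNIV. const (a l) * gen_y l)"
    by (simp add: lin_def sum_3 ext_scalar_hom const_eq gen_y_eq)
  then have "d0 (ext_scalar (lin a)) = (\<Sum>l\<in>UNIV. const (a l) * d0 (gen_y l))" by simp
  also have "\<dots> = (\<Sum>l\<in>UNIV. \<Sum>j\<in>UNIV. \<Sum>k\<in>UNIV. const (a l * c j k l) * gen_y j * gen_x k)"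
    by (simp add: d0_y sum_distrib_left const_eq ext_scalar_hom mult.assoc)
  also have "\<dots> = (\<Sum>j\<in>UNIV. \<Sum>l\<in>UNIV. \<Sum>k\<in>UNIV. const (a l * c j k l) * gen_y j * gen_x k)"
    by (rule sum.swap)
  also have "\<dots> = (\<Sum>j\<in>UNIV. \<Sum>k\<in>UNIV. \<Sum>l\<in>UNIV. const (a l * c j k l) * gen_y j * gen_x k)"
    by (intro sum.cong refl sum.swap)
  finally show ?thesis by (simp add: sum_3 const_eq ext_scalar_hom distrib_right)
qed

lemma entry_bracket: "(\<Sum>l\<in>UNIV. e l $ r $ s * c j k l) = bracket (e j) (e k) $ r $ s"
  unfolding brackets by (simp add: mat_scale_def mult.commute)

lemma trace_e: "e j $ 2 $ 2 = - (e j $ 1 $ 1)"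
proof -
  have "e j \<in> mat.span (range e)" by (rule mat.span_base) simp
  then have "e j $ 1 $ 1 + e j $ 2 $ 2 = 0"
    using basis by (simp add: sl2_basis_def sl2_def trace_def sum_2)
  then show ?thesis by (simp add: eq_neg_iff_add_eq_0 add.commute)
qed

lemma coord_bracket:
  "(\<Sum>l\<in>UNIV. coord 1 l * c j k l) = 2 * (coord 3 j * coord 1 k - coord 1 j * coord 3 k)"
  "(\<Sum>l\<in>UNIV. coord 2 l * c j k l) = 2 * (coord 2 j * coord 3 k - coord 3 j * coord 2 k)"
  "(\<Sum>l\<in>UNIV. coord 3 l * c j k l) = coord 1 j * coord 2 k - coord 2 j * coord 1 k"
  by (simp_all add: coord_def entry_bracket bracket_def matrix_matrix_mult_def sum_2 trace_e)

text \<open>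
  In matrix form the differential is \<open>d0 \<omega> = -\<omega>\<^sup>2\<close> and \<open>d0 r = [r, \<omega>]\<close>, and the structure constants
  disappear.  All later computations use these six formulas.
\<close>

lemma d0_Xi: "d0 Xi = - (ext_scalar 2 * (Zeta * Xi))"
  and d0_Eta: "d0 Eta = - (ext_scalar 2 * (Eta * Zeta))"
  and d0_Zeta: "d0 Zeta = - (Xi * Eta)"
  unfolding d0_lin_x coord_bracket two_form_scale lin_x_mult by (simp_all add: const_eq)

lemma d0_X: "d0 (ext_scalar X) = ext_scalar 2 * (ext_scalar Z * Xi - ext_scalar X * Zeta)"
  and d0_Y: "d0 (ext_scalar Y) = ext_scalar 2 * (ext_scalar Y * Zeta - ext_scalar Z * Eta)"
  and d0_Z: "d0 (ext_scalar Z) = ext_scalar X * Eta - ext_scalar Y * Xi"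
  unfolding d0_lin coord_bracket lin_lin_x_mult
  by (simp_all add: sum_3 const_eq ext_scalar_diff left_diff_distrib right_diff_distrib ext_scalar_hom mult.assoc distrib_left)

lemma d0_x_in: "d0 (gen_x l) \<in> E0_part 0 2"
  unfolding d0_x by (intro E0_part_uminus E0_part_sum)
    (auto simp: mult.assoc intro!: E0_part_const_mult gen_x2_in)

lemma d0_y_in: "d0 (gen_y l) \<in> E0_part 1 1"
  unfolding d0_y unfolding const_eq gen_y_eq mult.assoc ext_scalar_merge
  by (intro E0_part_sum scalar_gen_x_in homogeneous_cst_mult homogeneous_var)

lemma d0_part:
  assumes "a \<in> E0_part s t"
  shows "d0 a \<in> E0_part s (Suc t)"
proof -
  have "a \<in> E0_part s t \<and> d0 a \<in> E0_part s (Suc t)"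
    using assms
  proof (induction rule: E0_part_induct)
    case (zero s t)
    then show ?case by simp
  next
    case (add s t a b)
    then show ?case by (simp add: E0_part_add)
  next
    case (const c)
    have "const c \<in> E0_part 0 0" unfolding const_eq by (intro E0_part_scalar homogeneous_cst)
    then show ?case by simp
  next
    case (gen_x s t i a)
    have "gen_x i * a \<in> E0_part s (Suc t)" "gen_x i * d0 a \<in> E0_part s (Suc (Suc t))"
      "d0 (gen_x i) * a \<in> E0_part s (Suc (Suc t))"
      using E0_part_mult[OF E0_part_gen_x, of a s t i] E0_part_mult[OF E0_part_gen_x, of "d0 a" s "Suc t" i]
        E0_part_mult[OF d0_x_in, of a s t i] gen_x by simp_all
    then show ?case by (simp add: d_gen_x E0_part_diff)
  next
    case (gen_y s t i a)
    have "gen_y i \<in> E0_part 1 0" unfolding gen_y_eq by (intro E0_part_scalar homogeneous_var)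
    from E0_part_mult[OF this, of a s t] E0_part_mult[OF this, of "d0 a" s "Suc t"]
      E0_part_mult[OF d0_y_in, of a s t i]
    have "gen_y i * a \<in> E0_part (Suc s) t" "gen_y i * d0 a \<in> E0_part (Suc s) (Suc t)"
      "d0 (gen_y i) * a \<in> E0_part (Suc s) (Suc t)" using gen_y by simp_all
    then show ?case by (simp add: d_gen_y E0_part_add)
  qed
  then show ?thesis ..
qed

lemma d_lin_x: "d0 (lin_x a * z) = d0 (lin_x a) * z - lin_x a * d0 z"
  by (rule d_odd) (use lin_x_in in simp)

text \<open>
  These rules move polynomial factors to the front and sort one-forms into the order \<open>Xi\<close>, \<open>Eta\<close>,
  \<open>Zeta\<close>.
\<close>

lemmas normalize = ext_scalar_merge gen_x_scalar distrib_left distrib_right left_diff_distrib right_diff_distrib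
  mult.assoc ext_scalar_left_commute[of "lin_x _"] ext_scalar_central[of _ "lin_x _", symmetric]
  lin_x_square lin_x_mult_lin_x_mult lin_x_anticommute[of "coord 2" "coord 1"]
  lin_x_anticommute[of "coord 3" "coord 1"] lin_x_anticommute[of "coord 3" "coord 2"]
  lin_x_reorder[of "coord 2" "coord 1"] lin_x_reorder[of "coord 3" "coord 1"] lin_x_reorder[of "coord 3" "coord 2"]

lemma d0_2: "d0 (ext_scalar 2) = 0"
  using d_const[of 2] by (simp add: const_eq)

lemma d0_scalar_2: "d0 (ext_scalar (2 * p)) = ext_scalar 2 * d0 (ext_scalar p)"
  using d_scalar[of 2 "ext_scalar p"] by (simp add: d0_2 ext_scalar_hom)

text \<open>
  The Jacobi identity enters here, in the guise of the six matrix formulas.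
\<close>

lemma d0_d0_lin_x: "d0 (d0 (lin_x (coord a))) = 0"
  using exhaust_3[of a]
  by (elim disjE) (simp_all add: d0_Xi d0_Eta d0_Zeta d_scalar d0_2 d_lin_x normalize)

lemma d0_d0_lin: "d0 (d0 (ext_scalar (lin (coord a)))) = 0"
  using exhaust_3[of a]
  by (elim disjE) (simp_all add: d0_X d0_Y d0_Z d0_Xi d0_Eta d0_Zeta d_scalar d0_2 d0_scalar_2 normalize mult_ac)

lemma d0_d0_x: "d0 (d0 (gen_x l)) = 0"
  by (subst gen_x_eq_lin) (simp add: d0_d0_lin_x)

lemma d0_d0_y: "d0 (d0 (gen_y l)) = 0"
proof -
  have "gen_y l = (\<Sum>a\<in>UNIV. const (icoord l a) * ext_scalar (lin (coord a)))"
    unfolding gen_y_eq by (subst var_eq_lin) (simp add: sum_3 const_eq ext_scalar_hom)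
  then show ?thesis by (simp add: d0_d0_lin)
qed

lemma d0_d0:
  assumes "a \<in> E0_part s t"
  shows "d0 (d0 a) = 0"
  using assms
proof (induction rule: E0_part_induct)
  case (gen_x s t i a)
  have "d0 (d0 (gen_x i) * a) = d0 (gen_x i) * d0 a"
    using d_leibniz[OF d0_x_in, of i a] by (simp add: d0_d0_x)
  then show ?case using gen_x by (simp add: d_gen_x)
next
  case (gen_y s t i a)
  have "d0 (d0 (gen_y i) * a) = - (d0 (gen_y i) * d0 a)"
    using d_leibniz[OF d0_y_in, of i a] by (simp add: d0_d0_y)
  then show ?case using gen_y by (simp add: d_gen_y)
qed simp_all

end

locale sl2_bicomplex = sl2_complex d0 e c + K: koszul d1
  for d0 d1 :: "'k::field E0 \<Rightarrow> 'k E0" and e :: "3 \<Rightarrow> 'k^2^2" and c :: "3 \<Rightarrow> 3 \<Rightarrow> 3 \<Rightarrow> 'k"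
begin

lemma d1_lin_x: "d1 (lin_x a) = ext_scalar (lin a)"
  by (simp add: lin_x_def lin_def sum_3 K.d_x gen_y_eq const_eq ext_scalar_hom K.d_scalar_mult)

lemma d1_lin_x_mult: "d1 (lin_x a * z) = ext_scalar (lin a) * z - lin_x a * d1 z"
  using K.d_odd[of "lin_x a" 0 z] lin_x_in[of a] by (simp add: d1_lin_x)

lemma anticommute_lin_x: "d0 (d1 (lin_x (coord a))) + d1 (d0 (lin_x (coord a))) = 0"
  using exhaust_3[of a]
  by (elim disjE) (simp_all add: d0_X d0_Y d0_Z d0_Xi d0_Eta d0_Zeta d1_lin_x d1_lin_x_mult
      K.d_scalar_mult normalize mult_ac)

lemma anticommute_lin: "d1 (d0 (ext_scalar (lin (coord a)))) = 0"
  using exhaust_3[of a]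
  by (elim disjE) (simp_all add: d0_X d0_Y d0_Z d1_lin_x K.d_scalar_mult normalize mult_ac
      flip: ext_scalar_hom(2) ext_scalar_diff)

lemma anticommute_x: "d0 (d1 (gen_x l)) + d1 (d0 (gen_x l)) = 0"
proof -
  have "d0 (d1 (gen_x l)) + d1 (d0 (gen_x l))
    = (\<Sum>a\<in>UNIV. const (icoord l a) * (d0 (d1 (lin_x (coord a))) + d1 (d0 (lin_x (coord a)))))"
    by (subst (1 2) gen_x_eq_lin) (simp add: distrib_left sum.distrib)
  then show ?thesis by (simp add: anticommute_lin_x)
qed

lemma anticommute_y: "d1 (d0 (gen_y l)) = 0"
proof -
  have "gen_y l = (\<Sum>a\<in>UNIV. const (icoord l a) * ext_scalar (lin (coord a)))"
    unfolding gen_y_eq by (subst var_eq_lin) (simp add: sum_3 const_eq ext_scalar_hom)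
  then show ?thesis by (simp add: anticommute_lin)
qed

text \<open>
  The sum \<open>d0 d1 + d1 d0\<close> satisfies the Leibniz rule without signs, so it vanishes once it vanishes
  on generators; there \<open>d1 \<omega> = r\<close> turns \<open>d0 \<omega> = -\<omega>\<^sup>2\<close> into \<open>d0 r = [r, \<omega>]\<close>.
\<close>

lemma anticommute:
  assumes "a \<in> E0_part s t"
  shows "d0 (d1 a) = - d1 (d0 a)"
proof -
  have "d0 (d1 a) + d1 (d0 a) = 0"
    using assms
  proof (induction rule: E0_part_induct)
    case (add s t a b)
    then show ?case by (simp add: algebra_simps)
  next
    case (gen_x s t i a)
    have "d1 (d0 (gen_x i) * a) = d1 (d0 (gen_x i)) * a + d0 (gen_x i) * d1 a"
      using K.d_leibniz[OF d0_x_in, of i a] by simp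
    then have "d0 (d1 (gen_x i * a)) + d1 (d0 (gen_x i * a)) =
        (d0 (d1 (gen_x i)) + d1 (d0 (gen_x i))) * a + gen_x i * (d0 (d1 a) + d1 (d0 a))"
      by (simp add: d_gen_x K.d_gen_x K.d_x d_gen_y algebra_simps)
    then show ?case using gen_x by (simp add: anticommute_x)
  next
    case (gen_y s t i a)
    have "d1 (d0 (gen_y i) * a) = - (d0 (gen_y i) * d1 a)"
      using K.d_leibniz[OF d0_y_in, of i a] by (simp add: anticommute_y)
    then have "d0 (d1 (gen_y i * a)) + d1 (d0 (gen_y i * a)) = gen_y i * (d0 (d1 a) + d1 (d0 a))"
      by (simp add: d_gen_y K.d_gen_y K.d_y algebra_simps)
    then show ?case using gen_y by simp
  qed simp_all
  then show ?thesis by (simp add: eq_neg_iff_add_eq_0)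
qed

end

section \<open>The weight grading\<close>

text \<open>
  The weight under the diagonal torus, as an integer: the Lie algebra sees it only modulo the
  characteristic, while the argument below needs its sign.
\<close>

definition weight :: "(3 \<Rightarrow>\<^sub>0 nat) \<Rightarrow> int" where
  "weight m = int (Poly_Mapping.lookup m 1) - int (Poly_Mapping.lookup m 2)"

definition weights_in :: "int set \<Rightarrow> 'k::field poly3 \<Rightarrow> bool" where
  "weights_in J q \<longleftrightarrow> (\<forall>m\<in>Poly_Mapping.keys q. weight m \<in> J)"

lemma weights_in_0 [simp]: "weights_in J 0"
  by (simp add: weights_in_def)

lemma weights_in_add: "weights_in J p \<Longrightarrow> weights_in J q \<Longrightarrow> weights_in J (p + q)"
  using keys_add[of p q] by (auto simp: weights_in_def)

lemma weight_add: "weight (m + n) = weight m + weight n"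
  by (simp add: weight_def lookup_add)

lemma weights_in_mult:
  assumes "weights_in {a} p" "weights_in {b} q"
  shows "weights_in {a + b} (p * q)"
  unfolding weights_in_def
proof
  fix m assume "m \<in> Poly_Mapping.keys (p * q)"
  then obtain k l where "k \<in> Poly_Mapping.keys p" "l \<in> Poly_Mapping.keys q" "m = k + l"
    using keys_mult[of p q] by blast
  then show "weight m \<in> {a + b}" using assms by (simp add: weights_in_def weight_add)
qed

lemma weights_in_cst: "weights_in {0} (cst a)"
  by (simp add: weights_in_def cst_def weight_def)

lemma weights_in_var: "weights_in {weight (Poly_Mapping.single i 1)} (var i)"
  by (simp add: weights_in_def var_def)

lemma weight_single:
  "weight (Poly_Mapping.single 1 (Suc 0)) = 1" "weight (Poly_Mapping.single 2 (Suc 0)) = - 1"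
  "weight (Poly_Mapping.single 3 (Suc 0)) = 0"
  by (simp_all add: weight_def lookup_single)

lemma weights_in_subset: "weights_in I q \<Longrightarrow> I \<subseteq> J \<Longrightarrow> weights_in J q"
  by (auto simp: weights_in_def)

lemma weights_in_disjoint:
  assumes "weights_in A p" "weights_in B q" "p + q = 0" "A \<inter> B = {}"
  shows "p = 0"
proof -
  have "q = - p" using assms(3) by (simp add: eq_neg_iff_add_eq_0 add.commute)
  then have keys: "Poly_Mapping.keys q = Poly_Mapping.keys p" by (auto simp: in_keys_iff)
  have "m \<notin> Poly_Mapping.keys p" for m
    using assms(1,2,4) keys unfolding weights_in_def by blast
  then show ?thesis by (intro poly_mapping_eqI) (simp add: in_keys_iff)
qed

lemma var_dvd_if_keys:
  assumes "\<And>m. m \<in> Poly_Mapping.keys q \<Longrightarrow> Poly_Mapping.lookup m i \<noteq> 0"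
  shows "var i dvd q"
proof (induction q rule: sum_single_induct)
  case (single m)
  from assms[OF this] obtain m' where "m = Poly_Mapping.single i 1 + m'" by (rule monomial_split)
  then have "Poly_Mapping.single m (Poly_Mapping.lookup q m) = var i * Poly_Mapping.single m' (Poly_Mapping.lookup q m)"
    by (simp add: var_single)
  then show ?case by (rule dvdI)
qed simp_all

lemma lookup_var_mult_eq_0:
  assumes "Poly_Mapping.lookup m i = 0"
  shows "Poly_Mapping.lookup (var i * q) m = 0"
proof (rule ccontr)
  assume "Poly_Mapping.lookup (var i * q) m \<noteq> 0"
  then have "m \<in> Poly_Mapping.keys (var i * q)" by (simp add: in_keys_iff)
  then obtain k l where "k \<in> Poly_Mapping.keys (var i :: 'a poly3)" "m = k + l"
    using keys_mult[of "var i" q] by blast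
  then show False using assms by (simp add: var_def lookup_add split: if_splits)
qed

lemma lookup_kill:
  assumes "Poly_Mapping.lookup m i = 0"
  shows "Poly_Mapping.lookup (kill i q) m = Poly_Mapping.lookup q m"
proof -
  obtain r where "q - kill i q = var i * r" using var_dvd_minus_kill by blast
  then have "Poly_Mapping.lookup (q - kill i q) m = 0" using lookup_var_mult_eq_0[OF assms] by simp
  then show ?thesis by (simp add: lookup_minus)
qed

lemma kill_power [simp]: "kill i (q ^ n) = kill i q ^ n"
  by (simp add: kill_def)

lemma kill_numeral [simp]: "kill i (numeral n) = numeral n"
  using kill_simps(5)[of i "numeral n"] by simp

lemma var_power: "var i ^ n = Poly_Mapping.single (Poly_Mapping.single i n) 1"
  by (induction n) (simp_all add: var_def mult_single flip: single_add)

lemma dvd_power_diff: "b dvd (a + b) ^ n - a ^ n" for a b :: "'a::comm_ring_1"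
proof (induction n)
  case (Suc n)
  have "(a + b) ^ Suc n - a ^ Suc n = (a + b) * ((a + b) ^ n - a ^ n) + b * a ^ n"
    by (simp add: algebra_simps)
  then show ?case using Suc by simp
qed simp

context sl2_bicomplex
begin

text \<open>
  The substitution that reads its three variables as the matrix entries \<open>X\<close>, \<open>Y\<close>, \<open>Z\<close>.  A
  monomial of its source is thus a monomial in the matrix entries.
\<close>

definition coords :: "'k poly3 \<Rightarrow> 'k poly3" where
  "coords = subst (\<lambda>a. lin (coord a))"

lemma coords_simps [simp]:
  "coords (p + q) = coords p + coords q" "coords (p * q) = coords p * coords q"
  "coords (- p) = - coords p" "coords (p - q) = coords p - coords q"
  "coords (cst a) = cst a" "coords 0 = 0" "coords (p ^ n) = coords p ^ n"
  "coords (var i) = lin (coord i)"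
  by (simp_all add: coords_def)

lemma coords_numeral [simp]: "coords (numeral n) = numeral n"
  using coords_simps(5)[of "numeral n"] by simp

lemma homogeneous_coords: "q \<in> homogeneous s \<Longrightarrow> coords q \<in> homogeneous s"
  unfolding coords_def by (rule homogeneous_subst, assumption, rule homogeneous_lin)

lemma coords_inverse:
  obtains r where "\<And>q. r (coords q) = q" "\<And>q. coords (r q) = q"
    "\<And>q s. q \<in> homogeneous s \<Longrightarrow> r q \<in> homogeneous s"
proof
  fix q
  show "subst (\<lambda>i. lin (icoord i)) (coords q) = q"
    unfolding coords_def
  proof (rule subst_subst)
    fix a
    have "subst (\<lambda>i. lin (icoord i)) (lin (coord a))
        = (\<Sum>b\<in>UNIV. cst (\<Sum>i\<in>UNIV. coord a i * icoord i b) * var b)"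
      by (simp add: lin_def sum_3 algebra_simps)
    also have "\<dots> = (\<Sum>b\<in>UNIV. if a = b then var b else 0)"
      unfolding icoord_right by (intro sum.cong) auto
    finally show "subst (\<lambda>i. lin (icoord i)) (lin (coord a)) = var a" by simp
  qed
  show "coords (subst (\<lambda>i. lin (icoord i)) q) = q"
    unfolding coords_def
  proof (rule subst_subst)
    fix i
    have "subst (\<lambda>a. lin (coord a)) (lin (icoord i)) = (\<Sum>a\<in>UNIV. cst (icoord i a) * lin (coord a))"
      by (simp add: lin_def[of "icoord i"])
    then show "subst (\<lambda>a. lin (coord a)) (lin (icoord i)) = var i" by (simp flip: var_eq_lin)
  qed
qed (rule homogeneous_subst, assumption, rule homogeneous_lin)

lemma coords_eq_0_iff [simp]: "coords q = 0 \<longleftrightarrow> q = 0"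
  by (metis coords_inverse coords_simps(6))

definition coord_form :: "(3 \<Rightarrow> 'k poly3) \<Rightarrow> 'k E0" where
  "coord_form P = (\<Sum>a\<in>UNIV. ext_scalar (coords (P a)) * lin_x (coord a))"

lemma coord_form_add: "coord_form P + coord_form R = coord_form (\<lambda>a. P a + R a)"
  by (simp add: coord_form_def sum_3 ext_scalar_hom algebra_simps)

lemma coord_form_scale: "ext_scalar (coords p) * coord_form P = coord_form (\<lambda>a. p * P a)"
  by (simp add: coord_form_def sum_3 ext_scalar_hom distrib_left mult.assoc)

lemma coord_form_eq_0:
  assumes "coord_form P = 0"
  shows "P b = 0"
proof -
  have "ext_coeff (lin_x a) {j} = cst (a j)" for a :: "3 \<Rightarrow> 'k" and j
    by (simp add: lin_x_def ext_coeff_sum const_eq ext_scalar_mult gen_x_def ext_coeff_gen if_distrib cong: if_cong)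
  then have "ext_coeff (coord_form P) {j} = (\<Sum>a\<in>UNIV. coords (P a) * cst (coord a j))" for j
    by (simp add: coord_form_def ext_coeff_sum ext_scalar_mult)
  then have *: "(\<Sum>a\<in>UNIV. coords (P a) * cst (coord a j)) = 0" for j using assms by simp
  have "0 = (\<Sum>j\<in>UNIV. (\<Sum>a\<in>UNIV. coords (P a) * cst (coord a j)) * cst (icoord j b))"
    by (simp add: *)
  also have "\<dots> = (\<Sum>a\<in>UNIV. coords (P a) * cst (\<Sum>j\<in>UNIV. coord a j * icoord j b))"
    by (simp add: sum_3 algebra_simps)
  also have "\<dots> = (\<Sum>a\<in>UNIV. if a = b then coords (P a) else 0)"
    unfolding icoord_right by (intro sum.cong) auto
  finally show ?thesis by simp
qed

text \<open>
  If \<open>Xi\<close>, \<open>Eta\<close>, \<open>Zeta\<close> receive the weights \<open>1\<close>, \<open>-1\<close>, \<open>0\<close> of \<open>X\<close>, \<open>Y\<close>, \<open>Z\<close>, then \<open>d0\<close> preserves the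
  weight.  The coefficient of each of these one-forms is therefore shifted by the opposite amount.
\<close>

definition shift :: "3 \<Rightarrow> int" where
  "shift a = (if a = 1 then - 1 else if a = 2 then 1 else 0)"

lemma shift_simps: "shift 1 = - 1" "shift 2 = 1" "shift 3 = 0"
  by (simp_all add: shift_def)

lemma d0_var_weight:
  "\<exists>P. (\<forall>a. weights_in {weight (Poly_Mapping.single i 1) + shift a} (P a)) \<and>
     d0 (ext_scalar (coords (var i))) = coord_form P"
proof -
  have w: "weights_in {1} (var 1)" "weights_in {- 1} (var 2)" "weights_in {0} (var 3)"
    using weights_in_var[of 1] weights_in_var[of 2] weights_in_var[of 3] by (simp_all add: weight_single)
  have w2: "weights_in {j} (cst b * q)" if "weights_in {j} q" for j b q
    using weights_in_mult[OF weights_in_cst that] by simp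
  have all3: "(\<forall>a::3. R a) \<longleftrightarrow> R 1 \<and> R 2 \<and> R 3" for R by (rule forall_3)
  consider "i = 1" | "i = 2" | "i = 3" using exhaust_3[of i] by blast
  then show ?thesis
  proof cases
    case 1
    show ?thesis
      by (rule exI[of _ "\<lambda>a. if a = 1 then cst 2 * var 3 else if a = 2 then 0 else cst (- 2) * var 1"])
        (simp add: 1 all3 weight_single shift_simps w w2 d0_X coord_form_def sum_3 normalize del: cst_simps(4) cst_numeral, simp)
  next
    case 2
    show ?thesis
      by (rule exI[of _ "\<lambda>a. if a = 1 then 0 else if a = 2 then cst (- 2) * var 3 else cst 2 * var 2"])
        (simp add: 2 all3 weight_single shift_simps w w2 d0_Y coord_form_def sum_3 normalize del: cst_simps(4) cst_numeral, simp)
  next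
    case 3
    show ?thesis
      by (rule exI[of _ "\<lambda>a. if a = 1 then cst (- 1) * var 2 else if a = 2 then var 1 else 0"])
        (simp add: 3 all3 weight_single shift_simps w w2 d0_Z coord_form_def sum_3 normalize del: cst_simps(4), simp)
  qed
qed

lemma d0_monomial_weight:
  "\<exists>w. weights_in {w} (Poly_Mapping.single m a) \<and>
    (\<exists>P. (\<forall>b. weights_in {w + shift b} (P b)) \<and>
      d0 (ext_scalar (coords (Poly_Mapping.single m a))) = coord_form P)"
proof (induction rule: monomial_induct[where P = "\<lambda>_ q. \<exists>w. weights_in {w} q \<and>
    (\<exists>P. (\<forall>b. weights_in {w + shift b} (P b)) \<and> d0 (ext_scalar (coords q)) = coord_form P)"])
  case (const c)
  have "d0 (ext_scalar (coords (cst c))) = coord_form (\<lambda>_. 0)"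
    using d_const[of c] by (simp add: const_eq coord_form_def)
  then show ?case using weights_in_cst[of c]
    by (intro exI[of _ 0] conjI exI[of _ "\<lambda>_. 0"] allI) simp_all
next
  case (var s i q)
  then obtain w P where w: "weights_in {w} q" and P: "\<forall>b. weights_in {w + shift b} (P b)"
    "d0 (ext_scalar (coords q)) = coord_form P" by blast
  obtain P' where P': "\<forall>b. weights_in {weight (Poly_Mapping.single i 1) + shift b} (P' b)"
    "d0 (ext_scalar (coords (var i))) = coord_form P'" using d0_var_weight by blast
  let ?w = "weight (Poly_Mapping.single i 1) + w"
  have "d0 (ext_scalar (coords (var i * q))) = d0 (ext_scalar (coords (var i)) * ext_scalar (coords q))"
    by (simp only: coords_simps ext_scalar_hom)
  also have "\<dots> = ext_scalar (coords q) * coord_form P' + ext_scalar (coords (var i)) * coord_form P"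
    unfolding d_scalar P(2) P'(2) using ext_scalar_central[of "coords q" "coord_form P'"] by simp
  also have "\<dots> = coord_form (\<lambda>b. q * P' b + var i * P b)"
    unfolding coord_form_scale coord_form_add ..
  finally have "d0 (ext_scalar (coords (var i * q))) = coord_form (\<lambda>b. q * P' b + var i * P b)" .
  moreover have "weights_in {?w + shift b} (q * P' b + var i * P b)" for b
    using weights_in_mult[OF w P'(1)[rule_format, of b]] weights_in_mult[OF weights_in_var[of i] P(1)[rule_format, of b]]
    by (intro weights_in_add) (simp_all add: add_ac)
  moreover have "weights_in {?w} (var i * q)" by (rule weights_in_mult[OF weights_in_var w])
  ultimately show ?case
    by (intro exI[of _ ?w] conjI exI[of _ "\<lambda>b. q * P' b + var i * P b"] allI)
qed

lemma d0_weight: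
  assumes "weights_in J q"
  shows "\<exists>P. (\<forall>b. weights_in ((\<lambda>w. w + shift b) ` J) (P b)) \<and> d0 (ext_scalar (coords q)) = coord_form P"
proof (induction q rule: sum_single_induct)
  case zero
  have "d0 (ext_scalar (coords 0)) = coord_form (\<lambda>_. 0)" by (simp add: coord_form_def)
  then show ?case by (intro exI[of _ "\<lambda>_. 0"]) simp
next
  case (add p q)
  then obtain P R where "\<forall>b. weights_in ((\<lambda>w. w + shift b) ` J) (P b)" "d0 (ext_scalar (coords p)) = coord_form P"
    "\<forall>b. weights_in ((\<lambda>w. w + shift b) ` J) (R b)" "d0 (ext_scalar (coords q)) = coord_form R" by blast
  then show ?case
    by (intro exI[of _ "\<lambda>b. P b + R b"]) (simp add: weights_in_add ext_scalar_hom coord_form_add)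
next
  case (single m)
  obtain w P where w: "weights_in {w} (Poly_Mapping.single m (Poly_Mapping.lookup q m))"
    and P: "\<forall>b. weights_in {w + shift b} (P b)"
      "d0 (ext_scalar (coords (Poly_Mapping.single m (Poly_Mapping.lookup q m)))) = coord_form P"
    using d0_monomial_weight by blast
  have "weight m = w" using w single by (simp add: weights_in_def in_keys_iff)
  moreover have "weight m \<in> J" using assms single by (simp add: weights_in_def)
  ultimately have "{w + shift b} \<subseteq> (\<lambda>w. w + shift b) ` J" for b by blast
  then show ?case
    using P(2) weights_in_subset[OF P(1)[rule_format]] by (intro exI[of _ P] conjI allI) simp_all
qed

text \<open>
  Since \<open>d0\<close> preserves the weight, the differentials of two parts with disjoint sets of weights have
  no monomial in common and must vanish separately.
\<close>

lemma weight_split: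
  assumes "weights_in A u" "weights_in B v" "A \<inter> B = {}" "d0 (ext_scalar (coords (u + v))) = 0"
  shows "d0 (ext_scalar (coords u)) = 0"
proof -
  obtain P where P: "\<forall>b. weights_in ((\<lambda>w. w + shift b) ` A) (P b)" "d0 (ext_scalar (coords u)) = coord_form P"
    using d0_weight[OF assms(1)] by blast
  obtain R where R: "\<forall>b. weights_in ((\<lambda>w. w + shift b) ` B) (R b)" "d0 (ext_scalar (coords v)) = coord_form R"
    using d0_weight[OF assms(2)] by blast
  have "coord_form (\<lambda>b. P b + R b) = 0"
    using assms(4) by (simp add: ext_scalar_hom P R coord_form_add)
  then have "P b + R b = 0" for b by (rule coord_form_eq_0)
  moreover have "(\<lambda>w. w + shift b) ` A \<inter> (\<lambda>w. w + shift b) ` B = {}" for b using assms(3) by auto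
  ultimately have "P b = 0" for b
    by (rule weights_in_disjoint[OF P(1)[rule_format] R(1)[rule_format]])
  then show ?thesis by (simp add: P coord_form_def)
qed

end

section \<open>Lifting invariants to one-cocycles\<close>

context sl2_bicomplex
begin

definition lifts :: "nat \<Rightarrow> 'k poly3 \<Rightarrow> bool" where
  "lifts s p \<longleftrightarrow> (\<exists>F\<in>E0_part s 1. d0 F = 0 \<and> d1 F = ext_scalar p)"

lemma lifts_add: "lifts s p \<Longrightarrow> lifts s q \<Longrightarrow> lifts s (p + q)"
  unfolding lifts_def by (metis E0_part_add d_add K.d_add ext_scalar_hom(1) add_0_right)

lemma d0_scalar_mult_0:
  "d0 (ext_scalar p) = 0 \<Longrightarrow> d0 (ext_scalar q) = 0 \<Longrightarrow> d0 (ext_scalar (p * q)) = 0"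
  by (simp add: ext_scalar_hom d_scalar)

lemma d0_scalar_power_0: "d0 (ext_scalar p) = 0 \<Longrightarrow> d0 (ext_scalar (p ^ n)) = 0"
  by (induction n) (simp_all add: d0_scalar_mult_0)

lemma lifts_mult:
  assumes "d0 (ext_scalar p) = 0" "p \<in> homogeneous s" "lifts t q"
  shows "lifts (s + t) (p * q)"
proof -
  obtain F where F: "F \<in> E0_part t 1" "d0 F = 0" "d1 F = ext_scalar q"
    using assms(3) by (auto simp: lifts_def)
  have "ext_scalar p * F \<in> E0_part (s + t) 1" by (rule E0_part_scalar_mult[OF assms(2) F(1)])
  moreover have "d0 (ext_scalar p * F) = 0" using assms(1) F(2) by (simp add: d_scalar)
  moreover have "d1 (ext_scalar p * F) = ext_scalar (p * q)"
    by (simp add: K.d_scalar_mult F ext_scalar_hom)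
  ultimately show ?thesis unfolding lifts_def by blast
qed

text \<open>
  Formally, the cocycle \<open>A lam\<close> is the invariant \<open>l A\<close> times \<open>lam / l\<close>, and the assumption \<open>iso\<close> says
  that \<open>lam / l\<close> is closed.  To avoid denominators the differential of \<open>A lam\<close> is multiplied by \<open>l\<close>,
  which is cancelled at the end.  For a linear form \<open>l\<close> and its one-form \<open>lam\<close>, \<open>iso\<close> expresses that
  \<open>l\<close> is isotropic for the form dual to the determinant.
\<close>

lemma lifts_isotropic:
  assumes lam: "lam \<in> E0_part 0 1" "d1 lam = ext_scalar l" "l \<noteq> 0"
    and iso: "ext_scalar l * d0 lam = d0 (ext_scalar l) * lam"
    and A: "A \<in> homogeneous s" "d0 (ext_scalar (l * A)) = 0"
  shows "lifts s (l * A)"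
proof -
  have eq: "ext_scalar l * d0 (ext_scalar A) = - (ext_scalar A * d0 (ext_scalar l))"
    using A(2) by (simp add: ext_scalar_hom d_scalar eq_neg_iff_add_eq_0 add.commute
        ext_scalar_central[of A "d0 (ext_scalar l)"])
  have "ext_scalar l * d0 (ext_scalar A * lam)
      = (ext_scalar l * d0 (ext_scalar A)) * lam + ext_scalar A * (ext_scalar l * d0 lam)"
    by (simp add: d_scalar distrib_left mult.assoc ext_scalar_left_commute[of "ext_scalar A"])
  also have "\<dots> = 0" unfolding eq iso by (simp add: mult.assoc)
  finally have "d0 (ext_scalar A * lam) = 0" using lam(3) ext_scalar_cancel by blast
  moreover have "ext_scalar A * lam \<in> E0_part s 1"
    using E0_part_scalar_mult[OF A(1) lam(1)] by simp
  moreover have "d1 (ext_scalar A * lam) = ext_scalar (l * A)"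
    by (simp add: K.d_scalar_mult lam mult.commute flip: ext_scalar_hom(2))
  ultimately show ?thesis unfolding lifts_def by blast
qed

lemma lin_coord_neq_0: "lin (coord a) \<noteq> 0"
  using coords_eq_0_iff[of "var a"] by simp

text \<open>
  Split the invariant into its part of weight at least \<open>0\<close> and its part of negative weight; both are
  invariant.  A monomial of weight at least \<open>0\<close> that is not a power of \<open>Z\<close> contains \<open>X\<close>, and a monomial
  of negative weight contains \<open>Y\<close>.  Both \<open>X\<close> and \<open>Y\<close> are isotropic.
\<close>

lemma lifts_no_z_power:
  assumes q: "q \<in> homogeneous (Suc s)" "d0 (ext_scalar (coords q)) = 0"
    and z: "Poly_Mapping.lookup q (Poly_Mapping.single 3 (Suc s)) = 0"
  shows "lifts s (coords q)"
proof -
  define u where "u = Poly_Mapping.mapp (\<lambda>m a. if weight m \<ge> 0 then a else 0) q"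
  define v where "v = q - u"
  have lu: "Poly_Mapping.lookup u m = (if weight m \<ge> 0 then Poly_Mapping.lookup q m else 0)" for m
    by (simp add: u_def lookup_mapp when_def in_keys_iff)
  have lv: "Poly_Mapping.lookup v m = (if weight m \<ge> 0 then 0 else Poly_Mapping.lookup q m)" for m
    by (simp add: v_def lookup_minus lu)
  have uv: "u + v = q" by (simp add: v_def)
  have wu: "weights_in {0..} u" and wv: "weights_in {..<0} v"
    by (auto simp: weights_in_def in_keys_iff lu lv split: if_splits)
  have "d0 (ext_scalar (coords u)) = 0"
    by (rule weight_split[OF wu wv]) (auto simp: uv q(2))
  moreover have "d0 (ext_scalar (coords v)) = 0"
    by (rule weight_split[OF wv wu]) (auto simp: uv add.commute[of v] q(2))
  ultimately have d0: "d0 (ext_scalar (coords u)) = 0" "d0 (ext_scalar (coords v)) = 0" by auto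
  have hu: "u \<in> homogeneous (Suc s)" and hv: "v \<in> homogeneous (Suc s)"
    using q(1) by (auto simp: homogeneous_alt in_keys_iff lu lv split: if_splits)
  have "var 1 dvd u"
  proof (rule var_dvd_if_keys)
    fix m assume m: "m \<in> Poly_Mapping.keys u"
    then have w: "weight m \<ge> 0" and mq: "m \<in> Poly_Mapping.keys q"
      by (auto simp: in_keys_iff lu split: if_splits)
    show "Poly_Mapping.lookup m 1 \<noteq> 0"
    proof
      assume 1: "Poly_Mapping.lookup m 1 = 0"
      with w have 2: "Poly_Mapping.lookup m 2 = 0" by (simp add: weight_def)
      have "mdeg m = Suc s" using mq q(1) by (simp add: homogeneous_alt)
      then have 3: "Poly_Mapping.lookup m 3 = Suc s" using 1 2 by (simp add: mdeg_def sum_3)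
      have "m = Poly_Mapping.single 3 (Suc s)"
      proof (rule poly_mapping_eqI)
        fix i
        show "Poly_Mapping.lookup m i = Poly_Mapping.lookup (Poly_Mapping.single 3 (Suc s)) i"
          using exhaust_3[of i] 1 2 3 by (auto simp: lookup_single)
      qed
      then show False using z mq by (simp add: in_keys_iff)
    qed
  qed
  then obtain A where A: "u = var 1 * A" ..
  have "var 2 dvd v"
  proof (rule var_dvd_if_keys)
    fix m assume "m \<in> Poly_Mapping.keys v"
    then have "weight m < 0" by (auto simp: in_keys_iff lv split: if_splits)
    then show "Poly_Mapping.lookup m 2 \<noteq> 0" by (simp add: weight_def)
  qed
  then obtain B where B: "v = var 2 * B" ..
  have "lifts s (X * coords A)"
  proof (rule lifts_isotropic[where lam = Xi])
    show "coords A \<in> homogeneous s" using hu homogeneous_var_cancel homogeneous_coords A by blast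
    show "ext_scalar X * d0 Xi = d0 (ext_scalar X) * Xi"
      by (simp add: d0_X d0_Xi normalize mult_ac)
    show "d0 (ext_scalar (X * coords A)) = 0" using d0(1) by (simp add: A)
  qed (rule lin_x_in d1_lin_x lin_coord_neq_0)+
  moreover have "lifts s (Y * coords B)"
  proof (rule lifts_isotropic[where lam = Eta])
    show "coords B \<in> homogeneous s" using hv homogeneous_var_cancel homogeneous_coords B by blast
    show "ext_scalar Y * d0 Eta = d0 (ext_scalar Y) * Eta"
      by (simp add: d0_Y d0_Eta normalize mult_ac)
    show "d0 (ext_scalar (Y * coords B)) = 0" using d0(2) by (simp add: B)
  qed (rule lin_x_in d1_lin_x lin_coord_neq_0)+
  moreover have "coords q = X * coords A + Y * coords B"
    by (simp flip: uv add: A B)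
  ultimately show ?thesis using lifts_add by simp
qed

text \<open>
  The invariant quadratic form: minus the determinant of the generic matrix \<open>r\<close>.
\<close>

definition casimir :: "'k poly3" where
  "casimir = var 3 ^ 2 + var 1 * var 2"

lemma homogeneous_casimir: "casimir \<in> homogeneous 2"
  using homogeneous_power[OF homogeneous_var[of 3], of 2]
    homogeneous_mult[OF homogeneous_var[of 1] homogeneous_var[of 2]]
  unfolding casimir_def by (intro homogeneous_add) (simp_all add: numeral_2_eq_2)

lemma d0_casimir: "d0 (ext_scalar (coords casimir)) = 0"
proof -
  have "ext_scalar (coords casimir) = ext_scalar Z * ext_scalar Z + ext_scalar X * ext_scalar Y"
    by (simp add: casimir_def power2_eq_square ext_scalar_hom(1,2))
  note eq = this
  show ?thesis unfolding eq
    by (simp add: d_scalar d0_X d0_Y d0_Z normalize mult_ac)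
      (simp only: mult_2 ext_scalar_hom(1) distrib_right, simp)
qed

lemma kill_casimir: "kill 1 (kill 2 casimir) = var 3 ^ 2"
  by (simp add: casimir_def)

lemma ext_scalar_4: "ext_scalar (4 * p) = ext_scalar (2 * p) + ext_scalar (2 * p)"
  unfolding ext_scalar_hom(1)[symmetric] by (simp add: algebra_simps)

text \<open>
  A linear form \<open>\<alpha> X + \<beta> Y + \<gamma> Z\<close> is isotropic if and only if \<open>\<gamma>\<^sup>2 + 4 \<alpha> \<beta> = 0\<close>; the form \<open>X - Y + 2 Z\<close>
  is one that involves \<open>Z\<close>.  Its power is killed by every derivation when the exponent vanishes in
  the field.
\<close>

lemma lifts_isotropic_power:
  assumes "of_nat (Suc n) = (0 :: 'k)"
  shows "lifts n (coords ((var 1 - var 2 + cst 2 * var 3) ^ Suc n))"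
    and "d0 (ext_scalar (coords ((var 1 - var 2 + cst 2 * var 3) ^ Suc n))) = 0"
proof -
  let ?l = "X - Y + cst 2 * Z"
  let ?lam = "Xi - Eta + ext_scalar (cst 2) * Zeta"
  have n: "of_nat (Suc n) = (0 :: 'k poly3)" using assms by (metis cst_of_nat cst_simps(1))
  have d0: "d0 (ext_scalar (?l ^ Suc n)) = 0" unfolding d_scalar_power n by simp
  then show "d0 (ext_scalar (coords ((var 1 - var 2 + cst 2 * var 3) ^ Suc n))) = 0" by simp
  have hl: "var 1 - var 2 + cst 2 * var 3 \<in> homogeneous 1"
    by (intro homogeneous_add homogeneous_diff homogeneous_cst_mult homogeneous_var)
  have "lifts n (?l * ?l ^ n)"
  proof (rule lifts_isotropic[where lam = ?lam])
    show "?lam \<in> E0_part 0 1"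
      unfolding const_eq[symmetric] by (intro E0_part_add E0_part_diff E0_part_const_mult lin_x_in)
    show "d1 ?lam = ext_scalar ?l"
      by (simp add: d1_lin_x K.d_scalar_mult ext_scalar_diff ext_scalar_hom(1,2))
    show "?l \<noteq> 0"
    proof
      assume "?l = 0"
      then have "coords (var 1 - var 2 + cst 2 * var 3) = 0" by simp
      then have "var 1 - var 2 + cst 2 * var 3 = (0 :: 'k poly3)" by (simp only: coords_eq_0_iff)
      then have "kill 3 (kill 2 (var 1 - var 2 + cst 2 * var 3)) = (0 :: 'k poly3)"
        by (simp only: kill_simps)
      then show False by simp
    qed
    have "d0 (ext_scalar ?l) = d0 (ext_scalar X) - d0 (ext_scalar Y) + ext_scalar 2 * d0 (ext_scalar Z)"
      by (simp add: ext_scalar_diff ext_scalar_hom(1) d0_scalar_2)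
    moreover have "d0 ?lam = d0 Xi - d0 Eta + ext_scalar 2 * d0 Zeta"
      by (simp add: d_scalar d0_2)
    ultimately show "ext_scalar ?l * d0 ?lam = d0 (ext_scalar ?l) * ?lam"
      by (simp add: ext_scalar_diff ext_scalar_hom(1) d0_X d0_Y d0_Z d0_Xi d0_Eta d0_Zeta normalize mult_ac)
        (simp only: ext_scalar_4 distrib_right, simp add: algebra_simps)
    show "?l ^ n \<in> homogeneous n"
      using homogeneous_power[OF homogeneous_coords[OF hl], of n] by simp
    show "d0 (ext_scalar (?l * ?l ^ n)) = 0" using d0 by simp
  qed
  then show "lifts n (coords ((var 1 - var 2 + cst 2 * var 3) ^ Suc n))" by simp
qed

text \<open>
  Write \<open>Q\<close> for the quadratic form.  After inverting \<open>Y\<close>, both \<open>Q\<^sup>m / Y\<close> times \<open>Eta\<close> and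
  \<open>Z\<^sup>p\<close> times \<open>Zeta - (Z / Y) Eta\<close> are cocycles, because \<open>Q\<^sup>m\<close> and \<open>Z\<^sup>p\<close> are invariant.  Their values
  under \<open>d1\<close> are \<open>Q\<^sup>m\<close> and \<open>0\<close>, and for \<open>2 m = p + 1\<close> the poles cancel in the sum since \<open>Q\<close> is congruent
  to \<open>Z\<^sup>2\<close> modulo \<open>Y\<close>.  The proof checks the resulting polynomial cocycle \<open>B Eta + Z\<^sup>p Zeta\<close> after
  multiplication by \<open>Y\<close>.
\<close>

lemma lifts_casimir_power:
  assumes p: "of_nat p = (0 :: 'k)" and m: "2 * m = Suc p"
  shows "lifts p (coords (casimir ^ m))"
proof -
  have "var 1 * var 2 dvd casimir ^ m - (var 3 ^ 2) ^ m"
    unfolding casimir_def by (rule dvd_power_diff)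
  then have "var 2 dvd casimir ^ m - var 3 ^ Suc p"
    using m by (metis dvd_mult_right power_mult)
  then obtain B where B: "casimir ^ m - var 3 ^ Suc p = var 2 * B" ..
  have "casimir ^ m \<in> homogeneous (Suc p)"
    using homogeneous_power[OF homogeneous_casimir, of m] m by (simp add: mult.commute)
  moreover have "var 3 ^ Suc p \<in> homogeneous (Suc p)"
    using homogeneous_power[OF homogeneous_var, of 3 "Suc p"] by simp
  ultimately have "B \<in> homogeneous p"
    using homogeneous_diff B homogeneous_var_cancel by metis
  then have hB: "coords B \<in> homogeneous p" by (rule homogeneous_coords)
  have YB: "Y * coords B = coords casimir ^ m - Z ^ Suc p"
    using arg_cong[OF B, of coords] by simp
  have p': "of_nat p = (0 :: 'k poly3)" using p by (metis cst_of_nat cst_simps(1))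
  have dZp: "d0 (ext_scalar (Z ^ p)) = 0"
    using d_scalar_power[of Z "p - 1"] p' m by (cases p) (simp_all del: of_nat_Suc power_Suc)
  \<comment> \<open>The derivative of the (p+1)-st power has the factor p + 1 = 1.\<close>
  have dZ: "d0 (ext_scalar (Z ^ Suc p)) = ext_scalar (Z ^ p) * d0 (ext_scalar Z)"
    using d_scalar_power[of Z p] p' by simp
  have "d0 (ext_scalar Y * ext_scalar (coords B)) = - (ext_scalar (Z ^ p) * d0 (ext_scalar Z))"
    unfolding ext_scalar_hom(2)[symmetric] YB ext_scalar_diff d_diff dZ
      d0_scalar_power_0[OF d0_casimir] by simp
  then have YdB: "ext_scalar Y * d0 (ext_scalar (coords B))
      = - (ext_scalar (Z ^ p) * d0 (ext_scalar Z)) - ext_scalar (coords B) * d0 (ext_scalar Y)"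
    unfolding d_scalar using ext_scalar_central[of "coords B" "d0 (ext_scalar Y)"]
    by (simp add: algebra_simps)
  have hZ: "Z ^ p \<in> homogeneous p"
    using homogeneous_power[OF homogeneous_lin[of "coord 3"], of p] by simp
  let ?F = "ext_scalar (coords B) * Eta + ext_scalar (Z ^ p) * Zeta"
  have "ext_scalar Y * d0 ?F = (ext_scalar Y * d0 (ext_scalar (coords B))) * Eta
      + ext_scalar Y * (ext_scalar (coords B) * d0 Eta) + ext_scalar Y * (ext_scalar (Z ^ p) * d0 Zeta)"
    by (simp add: d_scalar dZp distrib_left mult.assoc)
  also have "\<dots> = 0"
    unfolding YdB by (simp add: d0_Y d0_Z d0_Eta d0_Zeta normalize mult_ac)
  finally have "d0 ?F = 0" using ext_scalar_cancel lin_coord_neq_0 by blast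
  moreover have "?F \<in> E0_part p 1"
    by (intro E0_part_add E0_part_scalar_mult[OF hB lin_x_in, unfolded add_0_right]
        E0_part_scalar_mult[OF hZ lin_x_in, unfolded add_0_right])
  moreover have "d1 ?F = ext_scalar (coords (casimir ^ m))"
  proof -
    have "coords (casimir ^ m) = coords B * Y + Z ^ p * Z"
      using YB by (simp add: algebra_simps)
    then show ?thesis by (simp add: K.d_scalar_mult d1_lin_x ext_scalar_hom)
  qed
  ultimately show ?thesis unfolding lifts_def by blast
qed

lemma lookup_z_power:
  assumes "kill 1 (kill 2 q) = cst a * var 3 ^ n"
  shows "Poly_Mapping.lookup q (Poly_Mapping.single 3 n) = a"
proof -
  have "Poly_Mapping.lookup q (Poly_Mapping.single 3 n) = Poly_Mapping.lookup (kill 1 (kill 2 q)) (Poly_Mapping.single 3 n)"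
    by (simp add: lookup_kill lookup_single)
  then show ?thesis by (simp add: assms var_power lookup_cst_mult)
qed

text \<open>
  In odd degree the power of an isotropic form supplies a power of \<open>Z\<close> with an invertible coefficient;
  in even degree, necessarily at least \<open>p + 1\<close>, the quadratic form does.  The missing degrees are filled
  by powers of the quadratic form, which have even degree and are invariant.
\<close>

lemma invariant_with_z_power:
  assumes p: "of_nat p = (0 :: 'k)" "odd p" and n: "n \<ge> p"
  obtains q where "q \<in> homogeneous n" "d0 (ext_scalar (coords q)) = 0" "lifts (n - 1) (coords q)"
    "Poly_Mapping.lookup q (Poly_Mapping.single 3 n) \<noteq> 0"
proof -
  have inv: "d0 (ext_scalar (coords (casimir ^ j))) = 0" for j
    using d0_scalar_power_0[OF d0_casimir] by simp
  have two: "(2 :: 'k) \<noteq> 0"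
  proof
    assume "(2 :: 'k) = 0"
    obtain k where "p = 2 * k + 1" using p(2) by (rule oddE)
    then have "of_nat p = (2 :: 'k) * of_nat k + 1" by simp
    then show False using p(1) \<open>(2 :: 'k) = 0\<close> by simp
  qed
  have hc: "casimir ^ j \<in> homogeneous (2 * j)" for j
    using homogeneous_power[OF homogeneous_casimir, of j] by (simp add: mult.commute)
  show ?thesis
  proof (cases "even n")
    case True
    then obtain k where k: "n = 2 * k" by blast
    define m where "m = (p + 1) div 2"
    have m: "2 * m = Suc p" using p(2) by (auto simp: m_def elim: oddE)
    then have "k \<ge> m" using n k p(2) by (auto elim!: oddE)
    then have km: "casimir ^ k = casimir ^ (k - m) * casimir ^ m" by (simp flip: power_add)
    show ?thesis
    proof (rule that[of "casimir ^ k"])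
      show "casimir ^ k \<in> homogeneous n" using hc k by simp
      show "d0 (ext_scalar (coords (casimir ^ k))) = 0" by (rule inv)
      have "lifts (2 * (k - m) + p) (coords (casimir ^ (k - m)) * coords (casimir ^ m))"
        by (rule lifts_mult[OF inv homogeneous_coords[OF hc] lifts_casimir_power[OF p(1) m]])
      moreover have "2 * (k - m) + p = n - 1" using k m \<open>k \<ge> m\<close> by linarith
      ultimately show "lifts (n - 1) (coords (casimir ^ k))" by (simp only: km coords_simps(2))
      have "kill 1 (kill 2 (casimir ^ k)) = cst 1 * var 3 ^ n"
        by (simp add: kill_casimir k power_mult)
      then have "Poly_Mapping.lookup (casimir ^ k) (Poly_Mapping.single 3 n) = 1" by (rule lookup_z_power)
      then show "Poly_Mapping.lookup (casimir ^ k) (Poly_Mapping.single 3 n) \<noteq> 0" by simp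
    qed
  next
    case False
    then obtain j where j: "n = 2 * j + p" using n p(2)
      by (metis add.commute even_diff_nat le_add_diff_inverse2 dvdE odd_add)
    obtain p' where p': "p = Suc p'" using p(2) by (cases p) auto
    let ?l = "(var 1 - var 2 + cst 2 * var 3) ^ p :: 'k poly3"
    have l: "lifts p' (coords ?l)" "d0 (ext_scalar (coords ?l)) = 0"
      using lifts_isotropic_power[of p'] p(1) by (simp_all only: p')
    have hl: "?l \<in> homogeneous p"
      using homogeneous_power[of "var 1 - var 2 + cst 2 * var 3" 1 p]
      by (simp add: homogeneous_add homogeneous_diff homogeneous_cst_mult homogeneous_var[unfolded One_nat_def] del: cst_numeral)
    show ?thesis
    proof (rule that[of "casimir ^ j * ?l"])
      show "casimir ^ j * ?l \<in> homogeneous n" unfolding j by (rule homogeneous_mult[OF hc hl])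
      show "d0 (ext_scalar (coords (casimir ^ j * ?l))) = 0"
        unfolding coords_simps(2)[of "casimir ^ j"] by (rule d0_scalar_mult_0[OF inv l(2)])
      have "lifts (2 * j + p') (coords (casimir ^ j) * coords ?l)"
        by (rule lifts_mult[OF inv homogeneous_coords[OF hc] l(1)])
      then show "lifts (n - 1) (coords (casimir ^ j * ?l))"
        unfolding coords_simps(2)[of "casimir ^ j"] by (simp add: j p' del: coords_simps)
      have "kill 1 (kill 2 (casimir ^ j * ?l)) = (var 3 ^ 2) ^ j * (cst 2 * var 3) ^ p"
        by (simp add: kill_casimir)
      also have "\<dots> = cst (2 ^ p) * var 3 ^ n"
        by (simp add: j power_add power_mult_distrib cst_power mult_ac flip: power_mult)
      finally have "Poly_Mapping.lookup (casimir ^ j * ?l) (Poly_Mapping.single 3 n) = 2 ^ p"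
        by (rule lookup_z_power)
      then show "Poly_Mapping.lookup (casimir ^ j * ?l) (Poly_Mapping.single 3 n) \<noteq> 0"
        using two by simp
    qed
  qed
qed

text \<open>
  Subtracting a multiple of the invariant just found removes the power of \<open>Z\<close>.  The bound \<open>n \<ge> p\<close>
  guarantees that such an invariant exists.
\<close>

lemma invariant_lifts:
  assumes p: "of_nat p = (0 :: 'k)" "odd p" and n: "n \<ge> p"
    and f: "f \<in> E0_part n 0" "d0 f = 0"
  shows "\<exists>F\<in>E0_part (n - 1) 1. d0 F = 0 \<and> d1 F = f"
proof -
  obtain f0 where f0: "f = ext_scalar f0" "f0 \<in> homogeneous n" using f(1) by (rule E0_part_zeroE)
  obtain q where q: "f0 = coords q" "q \<in> homogeneous n" using coords_inverse f0(2) by metis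
  obtain g where g: "g \<in> homogeneous n" "d0 (ext_scalar (coords g)) = 0" "lifts (n - 1) (coords g)"
    "Poly_Mapping.lookup g (Poly_Mapping.single 3 n) \<noteq> 0"
    using invariant_with_z_power[OF p n] by blast
  define b where "b = Poly_Mapping.lookup q (Poly_Mapping.single 3 n) / Poly_Mapping.lookup g (Poly_Mapping.single 3 n)"
  have n1: "n = Suc (n - 1)" using n p(2) by (cases n) auto
  have db: "d0 (ext_scalar (cst b)) = 0" using d_const[of b] by (simp add: const_eq)
  have "lifts (n - 1) (coords (q - cst b * g))"
  proof (rule lifts_no_z_power)
    show "q - cst b * g \<in> homogeneous (Suc (n - 1))"
      using n1 by (metis homogeneous_diff homogeneous_cst_mult q(2) g(1))
    show "d0 (ext_scalar (coords (q - cst b * g))) = 0"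
      using f(2) g(2) db by (simp add: f0 q ext_scalar_diff d0_scalar_mult_0)
    show "Poly_Mapping.lookup (q - cst b * g) (Poly_Mapping.single 3 (Suc (n - 1))) = 0"
      unfolding n1[symmetric] using g(4) by (simp add: lookup_minus lookup_cst_mult b_def)
  qed
  moreover have "lifts (0 + (n - 1)) (cst b * coords g)"
    by (rule lifts_mult[OF db homogeneous_cst g(3)])
  ultimately have "lifts (n - 1) (coords (q - cst b * g) + cst b * coords g)"
    unfolding add_0 by (rule lifts_add)
  then show ?thesis by (simp add: lifts_def f0 q)
qed

end

section \<open>The cohomology groups and the induced maps\<close>

definition cocycles :: "('k::field E0 \<Rightarrow> 'k E0) \<Rightarrow> nat \<Rightarrow> nat \<Rightarrow> 'k E0 set" where
  "cocycles d s t = {a \<in> E0_part s t. d a = 0}"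

text \<open>
  The coset of \<open>a\<close> is formed for every \<open>a\<close>, cocycle or not, which spares side conditions in rewriting.
\<close>

definition cohom_class :: "('k::field E0 \<Rightarrow> 'k E0) \<Rightarrow> nat \<Rightarrow> nat \<Rightarrow> 'k E0 \<Rightarrow> 'k E0 set" where
  "cohom_class d s t a = coboundaries d s t #>\<^bsub>cocycle_group d s t\<^esub> a"

lemma cocycle_group_simps [simp]:
  "carrier (cocycle_group d s t) = cocycles d s t" "monoid.mult (cocycle_group d s t) = (+)"
  "one (cocycle_group d s t) = 0"
  by (simp_all add: cocycle_group_def cocycles_def)

lemma cohom_class_eq: "cohom_class d s t a = (\<lambda>b. b + a) ` coboundaries d s t"
  by (auto simp: cohom_class_def r_coset_def)

context koszul
begin

lemma d_d: "a \<in> E0_part s t \<Longrightarrow> d (d a) = 0"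
proof (induction rule: E0_part_induct)
  case (gen_x s t i a)
  then show ?case by (simp add: d_gen_x d_gen_y d_x d_y)
next
  case (gen_y s t i a)
  then show ?case by (simp add: d_gen_y d_y)
qed simp_all

end

context derivation
begin

lemma cocycle_comm_group: "comm_group (cocycle_group d s t)"
proof (rule comm_groupI)
  fix a assume "a \<in> carrier (cocycle_group d s t)"
  then show "\<exists>b\<in>carrier (cocycle_group d s t). b \<otimes>\<^bsub>cocycle_group d s t\<^esub> a = \<one>\<^bsub>cocycle_group d s t\<^esub>"
    by (intro bexI[of _ "- a"]) (simp_all add: cocycles_def E0_part_uminus)
qed (simp_all add: cocycles_def E0_part_add algebra_simps)

end

context sl2_complex
begin

lemma coboundaries_diff: "a \<in> coboundaries d0 s t \<Longrightarrow> b \<in> coboundaries d0 s t \<Longrightarrow> a - b \<in> coboundaries d0 s t"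
  by (auto simp: coboundaries_def image_iff simp flip: d_diff intro: E0_part_diff split: if_splits)

lemma coboundaries_0: "0 \<in> coboundaries d0 s t"
  by (auto simp: coboundaries_def image_iff intro!: bexI[of _ 0])

lemma coboundaries_uminus: "a \<in> coboundaries d0 s t \<Longrightarrow> - a \<in> coboundaries d0 s t"
  using coboundaries_diff[OF coboundaries_0] by fastforce

lemma coboundaries_add: "a \<in> coboundaries d0 s t \<Longrightarrow> b \<in> coboundaries d0 s t \<Longrightarrow> a + b \<in> coboundaries d0 s t"
  using coboundaries_diff[OF _ coboundaries_uminus] by fastforce

lemma coboundaries_cocycles: "coboundaries d0 s t \<subseteq> cocycles d0 s t"
  using d0_part d0_d0 by (cases t) (auto simp: coboundaries_def cocycles_def)

lemma coboundaries_normal: "coboundaries d0 s t \<lhd> cocycle_group d0 s t"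
proof -
  interpret comm_group "cocycle_group d0 s t" by (rule cocycle_comm_group)
  have inv: "inv\<^bsub>cocycle_group d0 s t\<^esub> a = - a" if "a \<in> cocycles d0 s t" for a
    using that by (intro inv_equality) (auto simp: cocycles_def E0_part_uminus)
  then have "inv\<^bsub>cocycle_group d0 s t\<^esub> a \<in> coboundaries d0 s t" if "a \<in> coboundaries d0 s t" for a
    using that coboundaries_cocycles coboundaries_uminus by (metis subsetD)
  then have "subgroup (coboundaries d0 s t) (cocycle_group d0 s t)"
    by (intro subgroup.intro) (use coboundaries_cocycles in \<open>auto simp: coboundaries_0 coboundaries_add\<close>)
  then show ?thesis by (rule subgroup_imp_normal)
qed

lemma cohom_group: "group (cohom d0 t s)"
  unfolding cohom_def by (rule normal.factorgroup_is_group[OF coboundaries_normal])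

lemma carrier_cohom: "carrier (cohom d0 t s) = cohom_class d0 s t ` cocycles d0 s t"
  by (simp add: cohom_def carrier_FactGroup cohom_class_def)

lemma cohom_class_0: "cohom_class d0 s t 0 = \<one>\<^bsub>cohom d0 t s\<^esub>"
  by (simp add: cohom_def cohom_class_eq)

lemma cohom_class_eq_iff: "cohom_class d0 s t a = cohom_class d0 s t b \<longleftrightarrow> a - b \<in> coboundaries d0 s t"
proof
  assume "cohom_class d0 s t a = cohom_class d0 s t b"
  moreover have "a \<in> cohom_class d0 s t a" using coboundaries_0 by (force simp: cohom_class_eq)
  ultimately show "a - b \<in> coboundaries d0 s t" by (auto simp: cohom_class_eq)
next
  have sub: "cohom_class d0 s t a \<subseteq> cohom_class d0 s t b" if "a - b \<in> coboundaries d0 s t" for a b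
  proof
    fix z assume "z \<in> cohom_class d0 s t a"
    then obtain w where "w \<in> coboundaries d0 s t" "z = w + a" by (auto simp: cohom_class_eq)
    then have "w + (a - b) \<in> coboundaries d0 s t" "z = (w + (a - b)) + b"
      using coboundaries_add that by auto
    then show "z \<in> cohom_class d0 s t b" unfolding cohom_class_eq by blast
  qed
  assume *: "a - b \<in> coboundaries d0 s t"
  from coboundaries_uminus[OF this] have "b - a \<in> coboundaries d0 s t" by simp
  then show "cohom_class d0 s t a = cohom_class d0 s t b" using sub * by blast
qed

lemma cohom_class_eq_one_iff:
  "cohom_class d0 s t a = \<one>\<^bsub>cohom d0 t s\<^esub> \<longleftrightarrow> a \<in> coboundaries d0 s t"
  using cohom_class_eq_iff[of s t a 0] by (simp add: cohom_class_0)

lemma cohom_class_mult: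
  assumes "a \<in> cocycles d0 s t" "b \<in> cocycles d0 s t"
  shows "cohom_class d0 s t a \<otimes>\<^bsub>cohom d0 t s\<^esub> cohom_class d0 s t b = cohom_class d0 s t (a + b)"
  using normal.rcos_sum[OF coboundaries_normal, of a s t b] assms
  by (simp add: cohom_def cohom_class_def)

end

lemma coboundaryI: "b \<in> E0_part s t \<Longrightarrow> a = d b \<Longrightarrow> a \<in> coboundaries d s (Suc t)"
  by (simp add: coboundaries_def)

context sl2_bicomplex
begin

lemma d1_cocycles: "a \<in> cocycles d0 s (Suc t) \<Longrightarrow> d1 a \<in> cocycles d0 (Suc s) t"
  using K.d_part anticommute by (auto simp: cocycles_def)

text \<open>
  Because the differentials anticommute, \<open>d1 (d0 b) = d0 (- d1 b)\<close>.  In exterior degree \<open>0\<close> there is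
  no room for a coboundary, but there \<open>d1 b = 0\<close>.
\<close>

lemma d1_coboundaries:
  assumes "a \<in> coboundaries d0 s (Suc t)"
  shows "d1 a \<in> coboundaries d0 (Suc s) t"
proof -
  obtain b where b: "b \<in> E0_part s t" "a = d0 b" using assms by (auto simp: coboundaries_def)
  then have a: "d1 a = d0 (- d1 b)" using anticommute[OF b(1)] by simp
  show ?thesis
  proof (cases t)
    case 0
    then obtain q where "b = ext_scalar q" using b(1) E0_part_zeroE by metis
    then show ?thesis using 0 a by (simp add: coboundaries_def)
  next
    case (Suc t')
    then have "- d1 b \<in> E0_part (Suc s) t'" using K.d_part b(1) E0_part_uminus by blast
    then show ?thesis unfolding Suc using a by (rule coboundaryI)
  qed
qed

lemma cohom_map_class:
  assumes "a \<in> cocycles d0 s (Suc t)"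
  shows "cohom_map d0 d1 (Suc t) s (cohom_class d0 s (Suc t) a) = cohom_class d0 (Suc s) t (d1 a)"
proof -
  have "cohom_class d0 (Suc s) t (d1 (b + a)) = cohom_class d0 (Suc s) t (d1 a)"
    if "b \<in> coboundaries d0 s (Suc t)" for b
    using d1_coboundaries[OF that] by (simp add: cohom_class_eq_iff)
  then have "(\<lambda>a. cohom_class d0 (Suc s) t (d1 a)) ` cohom_class d0 s (Suc t) a = {cohom_class d0 (Suc s) t (d1 a)}"
    unfolding cohom_class_eq[of d0 s] using coboundaries_0[of s "Suc t"] by (auto simp: image_image)
  then show ?thesis by (simp add: cohom_map_def cohom_class_def)
qed

lemma cohom_map_hom: "cohom_map d0 d1 (Suc t) s \<in> hom (cohom d0 (Suc t) s) (cohom d0 t (Suc s))"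
proof (rule homI)
  fix A assume "A \<in> carrier (cohom d0 (Suc t) s)"
  then show "cohom_map d0 d1 (Suc t) s A \<in> carrier (cohom d0 t (Suc s))"
    using d1_cocycles by (auto simp: carrier_cohom cohom_map_class)
next
  fix A B assume "A \<in> carrier (cohom d0 (Suc t) s)" "B \<in> carrier (cohom d0 (Suc t) s)"
  then obtain a b where ab: "a \<in> cocycles d0 s (Suc t)" "A = cohom_class d0 s (Suc t) a"
    "b \<in> cocycles d0 s (Suc t)" "B = cohom_class d0 s (Suc t) b"
    by (auto simp: carrier_cohom)
  then have "a + b \<in> cocycles d0 s (Suc t)" by (auto simp: cocycles_def E0_part_add)
  then show "cohom_map d0 d1 (Suc t) s (A \<otimes>\<^bsub>cohom d0 (Suc t) s\<^esub> B) =
      cohom_map d0 d1 (Suc t) s A \<otimes>\<^bsub>cohom d0 t (Suc s)\<^esub> cohom_map d0 d1 (Suc t) s B"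
    using ab d1_cocycles by (simp add: cohom_class_mult cohom_map_class)
qed

lemma kernel_cohom_map:
  "kernel (cohom d0 (Suc t) s) (cohom d0 t (Suc s)) (cohom_map d0 d1 (Suc t) s) =
    cohom_class d0 s (Suc t) ` {a \<in> cocycles d0 s (Suc t). d1 a \<in> coboundaries d0 (Suc s) t}"
proof -
  have "cohom_map d0 d1 (Suc t) s (cohom_class d0 s (Suc t) a) = \<one>\<^bsub>cohom d0 t (Suc s)\<^esub> \<longleftrightarrow>
      d1 a \<in> coboundaries d0 (Suc s) t" if "a \<in> cocycles d0 s (Suc t)" for a
    by (simp only: cohom_map_class[OF that] cohom_class_eq_one_iff)
  then show ?thesis unfolding kernel_def carrier_cohom by blast
qed

lemma image_cohom_map:
  "cohom_map d0 d1 (Suc t) s ` carrier (cohom d0 (Suc t) s) =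
    cohom_class d0 (Suc s) t ` d1 ` cocycles d0 s (Suc t)"
  unfolding carrier_cohom by (force simp: cohom_map_class image_iff)

lemma exact_at:
  assumes "\<And>a. a \<in> cocycles d0 (Suc s) (Suc t) \<Longrightarrow> d1 a \<in> coboundaries d0 (Suc (Suc s)) t \<Longrightarrow>
      \<exists>b\<in>cocycles d0 s (Suc (Suc t)). a - d1 b \<in> coboundaries d0 (Suc s) (Suc t)"
  shows "kernel (cohom d0 (Suc t) (Suc s)) (cohom d0 t (Suc (Suc s))) (cohom_map d0 d1 (Suc t) (Suc s)) =
    cohom_map d0 d1 (Suc (Suc t)) s ` carrier (cohom d0 (Suc (Suc t)) s)"
proof -
  have "d1 (d1 b) = 0" if "b \<in> E0_part s (Suc (Suc t))" for b
    using K.d_d[OF that] .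
  then have "d1 b \<in> {a \<in> cocycles d0 (Suc s) (Suc t). d1 a \<in> coboundaries d0 (Suc (Suc s)) t}"
    if "b \<in> cocycles d0 s (Suc (Suc t))" for b
    using that d1_cocycles coboundaries_0 by (auto simp: cocycles_def)
  moreover have "cohom_class d0 (Suc s) (Suc t) a \<in> cohom_class d0 (Suc s) (Suc t) ` d1 ` cocycles d0 s (Suc (Suc t))"
    if a: "a \<in> cocycles d0 (Suc s) (Suc t)" "d1 a \<in> coboundaries d0 (Suc (Suc s)) t" for a
  proof -
    obtain b where "b \<in> cocycles d0 s (Suc (Suc t))" "a - d1 b \<in> coboundaries d0 (Suc s) (Suc t)"
      using assms[OF a] by blast
    then show ?thesis by (auto simp flip: cohom_class_eq_iff)
  qed
  ultimately show ?thesis unfolding kernel_cohom_map image_cohom_map by blast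
qed

end

section \<open>The double complex chase\<close>

context sl2_bicomplex
begin

lemma cocycles_3: "cocycles d0 s 3 = E0_part s 3"
  using d0_part E0_part_gt_3 by (fastforce simp: cocycles_def)

text \<open>
  Coboundaries vanish in exterior degree \<open>0\<close>, so \<open>a\<close> itself is Koszul closed, say \<open>a = d1 b\<close>.  Then
  \<open>d1 (d0 b) = 0\<close>, and injectivity of \<open>d1\<close> on three-forms makes \<open>b\<close> a cocycle.
\<close>

lemma exact_at_H1:
  assumes "a \<in> cocycles d0 (Suc s) 1" "d1 a \<in> coboundaries d0 (Suc (Suc s)) 0"
  shows "\<exists>b\<in>cocycles d0 s 2. a - d1 b \<in> coboundaries d0 (Suc s) 1"
proof -
  have a: "a \<in> E0_part (Suc s) 1" "d0 a = 0" "d1 a = 0"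
    using assms by (auto simp: cocycles_def coboundaries_def)
  then obtain b where b: "b \<in> E0_part s 2" "d1 b = a" using K.exact_1 by blast
  have "d1 (d0 b) = 0" using anticommute[OF b(1)] b(2) a(2) by simp
  moreover have "d0 b \<in> E0_part s 3" using d0_part[OF b(1)] by (simp add: numeral_3_eq_3 numeral_2_eq_2)
  ultimately have "d0 b = 0" using K.exact_3 by blast
  then show ?thesis using b coboundaries_0 by (intro bexI[of _ b]) (auto simp: cocycles_def)
qed

text \<open>
  If \<open>d1 a = d0 g\<close>, lift the polynomial \<open>g\<close> to \<open>g = d1 F\<close>; changing \<open>a\<close> by the coboundary \<open>d0 F\<close> makes
  it Koszul closed, hence \<open>d1\<close> of a three-form, and every three-form is a cocycle.
\<close>

lemma exact_at_H2:
  assumes "a \<in> cocycles d0 (Suc s) 2" "d1 a \<in> coboundaries d0 (Suc (Suc s)) 1"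
  shows "\<exists>b\<in>cocycles d0 s 3. a - d1 b \<in> coboundaries d0 (Suc s) 2"
proof -
  have a: "a \<in> E0_part (Suc s) 2" using assms by (auto simp: cocycles_def)
  obtain g where g: "g \<in> E0_part (Suc (Suc s)) 0" "d1 a = d0 g"
    using assms(2) by (auto simp: coboundaries_def)
  obtain F where F: "F \<in> E0_part (Suc s) 1" "d1 F = g" using K.exact_0[OF g(1)] by blast
  have d0F: "d0 F \<in> E0_part (Suc s) 2" using d0_part[OF F(1)] by (simp only: Suc_1)
  have "d1 (a + d0 F) = 0" using anticommute[OF F(1)] g F by simp
  then obtain b where b: "b \<in> E0_part s 3" "d1 b = a + d0 F"
    using K.exact_2 E0_part_add[OF a d0F] by blast
  have "a - d1 b = d0 (- F)" using b by simp
  with E0_part_uminus[OF F(1)] have "a - d1 b \<in> coboundaries d0 (Suc s) (Suc 1)"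
    by (rule coboundaryI)
  then have "a - d1 b \<in> coboundaries d0 (Suc s) 2" by (simp only: Suc_1)
  then show ?thesis using b cocycles_3 by blast
qed

text \<open>
  If \<open>d1 a = d0 F\<close>, then \<open>d1 F\<close> is an invariant of degree \<open>i + 2\<close>; it obstructs a further lift through
  the Koszul rows.  By \<open>invariant_lifts\<close> it is also \<open>d1 F'\<close> for a cocycle \<open>F'\<close>, and replacing \<open>F\<close> by
  \<open>F - F'\<close> removes the obstruction: \<open>F - F' = d1 G\<close> and \<open>a = - d0 G\<close>.
\<close>

lemma injective_at_H3:
  assumes p: "of_nat p = (0 :: 'k)" "odd p" and i: "i \<ge> p - 2"
    and a: "a \<in> E0_part i 3" "d1 a \<in> coboundaries d0 (Suc i) 2"
  shows "a \<in> coboundaries d0 i 3"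
proof -
  obtain F where F: "F \<in> E0_part (Suc i) 1" "d1 a = d0 F"
    using a(2) by (auto simp: coboundaries_def)
  have d1F: "d1 F \<in> E0_part (Suc (Suc i)) 0" using K.d_part[of F "Suc i" 0] F(1) by simp
  have "d1 (d1 a) = 0" using K.d_d[OF a(1)] .
  then have "d0 (d1 F) = 0" using anticommute[OF F(1)] F(2) by simp
  moreover have "Suc (Suc i) \<ge> p" using i by linarith
  ultimately have "\<exists>F'\<in>E0_part (Suc (Suc i) - 1) 1. d0 F' = 0 \<and> d1 F' = d1 F"
    using invariant_lifts[OF p _ d1F] by blast
  then obtain F' where F': "F' \<in> E0_part (Suc i) 1" "d0 F' = 0" "d1 F' = d1 F" by auto
  have "d1 (F - F') = 0" using F' by simp
  then obtain G where G: "G \<in> E0_part i 2" "d1 G = F - F'"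
    using K.exact_1 E0_part_diff[OF F(1) F'(1)] by blast
  have d0G: "d0 G \<in> E0_part i 3" using d0_part[OF G(1)] by (simp add: numeral_3_eq_3 numeral_2_eq_2)
  have "d1 (a + d0 G) = 0" using F F' G anticommute[OF G(1)] by simp
  then have "a + d0 G = 0" using K.exact_3 E0_part_add[OF a(1) d0G] by blast
  then have "a = d0 (- G)" by (simp add: eq_neg_iff_add_eq_0)
  with E0_part_uminus[OF G(1)] have "a \<in> coboundaries d0 i (Suc 2)" by (rule coboundaryI)
  then show ?thesis by (simp add: numeral_3_eq_3 numeral_2_eq_2)
qed

end

text \<open>
  Translation by \<open>1\<close> permutes the field, so the sum of all elements does not change when \<open>1\<close> is added
  to each of them.
\<close>

lemma of_nat_CARD:
  assumes "CARD('k::field) = p"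
  shows "of_nat p = (0 :: 'k)"
proof -
  have "(\<Sum>x\<in>UNIV. x) = (\<Sum>x\<in>UNIV. x + (1 :: 'k))"
    by (rule sum.reindex_bij_witness[of _ "\<lambda>x. x + 1" "\<lambda>x. x - 1"]) auto
  then show ?thesis using assms by (simp add: sum.distrib)
qed

theorem corollary9p3:
  fixes p i :: nat
    and e :: "3 \<Rightarrow> 'k::field^2^2"
    and c :: "3 \<Rightarrow> 3 \<Rightarrow> 3 \<Rightarrow> 'k"
    and d0 d1 :: "'k E0 \<Rightarrow> 'k E0"
  assumes "prime p" and "odd p" and "CARD('k) = p"
    and "sl2_basis e"
    and "\<And>j k. bracket (e j) (e k) = (\<Sum>l\<in>UNIV. mat_scale (c j k l) (e l))"
    and "graded_derivation d0"
    and "\<And>l. d0 (gen_x l) = - (\<Sum>(j, k)\<in>{(j, k). j < k}. const (c j k l) * gen_x j * gen_x k)"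
    and "\<And>l. d0 (gen_y l) = (\<Sum>j\<in>UNIV. \<Sum>k\<in>UNIV. const (c j k l) * gen_y j * gen_x k)"
    and "graded_derivation d1"
    and "\<And>l. d1 (gen_x l) = gen_y l"
    and "\<And>l. d1 (gen_y l) = 0"
    and "i \<ge> p - 2"
  shows "exact_seq
    ([singleton_group {0},
      cohom d0 0 (i + 3), cohom d0 1 (i + 2), cohom d0 2 (i + 1), cohom d0 3 i,
      singleton_group {0}],
     [\<lambda>_. {0},
      cohom_map d0 d1 1 (i + 2), cohom_map d0 d1 2 (i + 1), cohom_map d0 d1 3 i,
      \<lambda>_. \<one>\<^bsub>cohom d0 3 i\<^esub>])"
proof -
  interpret sl2_bicomplex d0 d1 e c
    by unfold_locales (use assms in auto)
  have p: "of_nat p = (0 :: 'k)" using assms(3) by (rule of_nat_CARD)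
  have H3: "kernel (cohom d0 3 i) (cohom d0 2 (i + 1)) (cohom_map d0 d1 3 i) =
      (\<lambda>_. \<one>\<^bsub>cohom d0 3 i\<^esub>) ` carrier (singleton_group {0})"
  proof -
    have "{a \<in> cocycles d0 i 3. d1 a \<in> coboundaries d0 (Suc i) 2} = coboundaries d0 i 3"
      using injective_at_H3[OF p assms(2,12)] coboundaries_cocycles[of i 3] d1_coboundaries[of _ i 2]
      by (auto simp: cocycles_3)
    moreover have "cohom_class d0 i 3 ` coboundaries d0 i 3 = {\<one>\<^bsub>cohom d0 3 i\<^esub>}"
    proof -
      have "cohom_class d0 i 3 a = \<one>\<^bsub>cohom d0 3 i\<^esub>" if "a \<in> coboundaries d0 i 3" for a
        using that by (simp only: cohom_class_eq_one_iff)
      then show ?thesis using coboundaries_0[of i 3] by blast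
    qed
    ultimately show ?thesis
      using kernel_cohom_map[of 2 i] by simp
  qed
  have H2: "kernel (cohom d0 2 (i + 1)) (cohom d0 1 (i + 2)) (cohom_map d0 d1 2 (i + 1)) =
      cohom_map d0 d1 3 i ` carrier (cohom d0 3 i)"
    using exact_at[of i 1] exact_at_H2[of _ i] by (simp add: numeral_3_eq_3 numeral_2_eq_2)
  have H1: "kernel (cohom d0 1 (i + 2)) (cohom d0 0 (i + 3)) (cohom_map d0 d1 1 (i + 2)) =
      cohom_map d0 d1 2 (i + 1) ` carrier (cohom d0 2 (i + 1))"
    using exact_at[of "Suc i" 0] exact_at_H1[of _ "Suc i"] by (simp add: numeral_3_eq_3 numeral_2_eq_2)
  \<comment> \<open>The last map is zero, so exactness there means that every invariant of degree i + 3 lifts.\<close>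
  have H0: "kernel (cohom d0 0 (i + 3)) (singleton_group {0}) (\<lambda>_. {0}) =
      cohom_map d0 d1 1 (i + 2) ` carrier (cohom d0 1 (i + 2))"
  proof -
    have "cocycles d0 (i + 3) 0 \<subseteq> d1 ` cocycles d0 (i + 2) 1"
    proof
      fix f assume "f \<in> cocycles d0 (i + 3) 0"
      then have "f \<in> E0_part (i + 3) 0" "d0 f = 0" by (simp_all add: cocycles_def)
      moreover have "i + 3 \<ge> p" using assms(12) by linarith
      ultimately have "\<exists>F\<in>E0_part (i + 3 - 1) 1. d0 F = 0 \<and> d1 F = f"
        using invariant_lifts[OF p assms(2)] by blast
      moreover have "i + 3 - 1 = i + 2" by simp
      ultimately show "f \<in> d1 ` cocycles d0 (i + 2) 1" unfolding cocycles_def by force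
    qed
    moreover have "d1 ` cocycles d0 (i + 2) 1 \<subseteq> cocycles d0 (i + 3) 0"
      using d1_cocycles[of _ "i + 2" 0] by (auto simp: numeral_3_eq_3)
    ultimately have "carrier (cohom d0 0 (i + 3)) = cohom_class d0 (i + 3) 0 ` d1 ` cocycles d0 (i + 2) 1"
      unfolding carrier_cohom by blast
    also have "\<dots> = cohom_map d0 d1 1 (i + 2) ` carrier (cohom d0 1 (i + 2))"
      using image_cohom_map[of 0 "i + 2"] by (simp add: numeral_3_eq_3)
    finally show ?thesis by (simp add: kernel_def singleton_group_def)
  qed
  have hom: "cohom_map d0 d1 3 i \<in> hom (cohom d0 3 i) (cohom d0 2 (i + 1))"
    "cohom_map d0 d1 2 (i + 1) \<in> hom (cohom d0 2 (i + 1)) (cohom d0 1 (i + 2))"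
    "cohom_map d0 d1 1 (i + 2) \<in> hom (cohom d0 1 (i + 2)) (cohom d0 0 (i + 3))"
    using cohom_map_hom[of 2 i] cohom_map_hom[of 1 "i + 1"] cohom_map_hom[of 0 "i + 2"]
    by (simp_all add: numeral_3_eq_3 numeral_2_eq_2)
  have start: "group_hom (singleton_group {0}) (cohom d0 3 i) (\<lambda>_. \<one>\<^bsub>cohom d0 3 i\<^esub>)"
    using cohom_group[of 3 i] by (simp add: group_hom_def group_hom_axioms_def trivial_hom)
  have final: "(\<lambda>_. {0}) \<in> hom (cohom d0 0 (i + 3)) (singleton_group {0})"
    by (simp add: hom_def singleton_group_def)
  show ?thesis
    by (intro exact_seq.extension exact_seq.unity cohom_group singleton_group start final hom H0 H1 H2 H3)
qed

end
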